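(* For every real $x\ge 1$, let $G_3(x)$ denote the maximum total side length of three interior-disjoint squares, with arbitrary orientations, contained in a $1\times x$ rectangle. Then for every $x\ge 1$, \[ G_3(x)= \begin{cases} x+\tfrac12, & 1\le x\le\tfrac32,\\ 2, & \tfrac32\le x\le2,\\ x, & 2\le x\le3,\\ 3, & x\ge3. \end{cases} \]
   Context: A square means a closed solid (filled) square in the Euclidean plane $\mathbb{R}^2$, of positive side length and arbitrary orientation (not necessarily axis-parallel); the three squares may have different side lengths and orientations. Interior-disjoint means that the interiors are pairwise disjoint. The $1\times x$ rectangle may be taken to be $[0,1]\times[0,x]$. That $G_3(x)$ is the maximum means that it is the largest value of the sum of the three side lengths over all such configurations, and it is attained. *)

theory Defs
  imports "HOL-Analysis.Analysis"
begin

text \<open>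
  The type \<^typ>\<open>real \<times> real\<close> carries the Euclidean inner product and norm. The orthonormal
  vectors \<open>u\<close>, \<open>v\<close> are the directions of the sides and \<open>c\<close> is a corner.
\<close>

definition is_square :: "(real \<times> real) set \<Rightarrow> real \<Rightarrow> bool" where
  "is_square S s \<longleftrightarrow> s > 0 \<and>
    (\<exists>c u v. norm u = 1 \<and> norm v = 1 \<and> u \<bullet> v = 0 \<and>
       S = {c + a *\<^sub>R u + b *\<^sub>R v | a b. a \<in> {0..s} \<and> b \<in> {0..s}})"

definition square_packing ::
    "nat \<Rightarrow> real \<Rightarrow> (nat \<Rightarrow> (real \<times> real) set) \<Rightarrow> (nat \<Rightarrow> real) \<Rightarrow> bool" where
  "square_packing n x S s \<longleftrightarrow>
    (\<forall>i<n. is_square (S i) (s i) \<and> S i \<subseteq> {0..1} \<times> {0..x}) \<and>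
    disjoint_family_on (\<lambda>i. interior (S i)) {..<n}"

definition total_side_lengths :: "nat \<Rightarrow> real \<Rightarrow> real set" where
  "total_side_lengths n x = {(\<Sum>i<n. s i) | S s. square_packing n x S s}"

text \<open>
  \<^term>\<open>Greatest\<close> is an unspecified number if there is no greatest element, so a claim about
  the value of \<open>G\<close> has to be accompanied by the claim that the maximum is attained.
\<close>

definition G :: "nat \<Rightarrow> real \<Rightarrow> real" where
  "G n x = (GREATEST t. t \<in> total_side_lengths n x)"

end

theory Submission
  imports Defs
begin

text \<open>
  Call a square stacked below another if some non-vertical line has the first below it and the
  second above it. Two interior-disjoint squares are separated by a line; if the line is vertical,
  their sides add up to at most the width 1. So two squares in the unit-width rectangle whose sides
  add up to more than 1 are stacked, one way or the other.

  Consider three squares of sides \<open>b\<close>, \<open>m\<close>, \<open>t\<close>, each stacked below the next, with separating lines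
  \<open>l\<close> and \<open>l'\<close>. On a vertical line at abscissa \<open>\<tau>\<close>, consider the gaps from the floor to \<open>l\<close>, from \<open>l\<close> to \<open>l'\<close>,
  and from \<open>l'\<close> to the lid. If they are at least \<open>b\<close>, \<open>m\<close> and \<open>t\<close>, then \<open>b + m + t\<close> is at most the
  height. The gaps are affine in \<open>\<tau>\<close>, so each condition holds on an interval that starts at one of
  the walls. The central estimate is that the interval of a square of side \<open>s\<close> has length at least
  \<open>s\<close>: an axis-parallel square that touches the wall is the worst case. This holds for the bottom and
  the top square whatever the slope (\<open>square_le_slanted_lid\<close>), and for the middle one if the slopes
  of the two lines differ by at most 1 (\<open>square_le_vertical_gap\<close>). If all pairs of sides add up to at
  least 1, the intervals meet pairwise, hence have a common point (\<open>anchored_common\<close>).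
  The same argument with one line gives \<open>s + t \<le> max 1 h\<close> for two squares.

  For lines of very different slopes the middle interval can be shorter than \<open>m\<close>. A square of side
  \<open>1/2\<close> tilted by \<open>\<pi>/4\<close> that touches one wall, between two axis-parallel squares of side \<open>1/2\<close> that touch
  the other wall, shows that then the sum can exceed the height. In a rectangle of height
  \<open>h \<ge> 2\<close> this does no harm. A sum above \<open>h\<close> forces every pair of sides above 1, with a
  surplus over 1 at least as large as the gap between the third side and 1. A vertical chord of length
  \<open>m\<close> inside the middle square shows that its interval has length at least \<open>9 m / 10\<close> and at least
  \<open>2 m - 1\<close>, which suffices unless the top (or bottom) square is larger and nearly fills the width. A
  square that large is almost axis-parallel, and the middle square can be separated from it by a
  line of slope at most \<open>1/3\<close> (\<open>shallow_separator_below_large_square\<close>). If the other line has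
  slope at most \<open>2/3\<close>, the slopes differ by at most 1. If it is steeper, a horizontal line can
  replace the shallow one; the error committed at the large square is outweighed by what the steep line
  gains (\<open>stack_below_large_square\<close>). Hence the sum is at most \<open>h\<close> for \<open>h \<ge> 2\<close>, and at most \<open>2\<close> for
  \<open>h \<le> 2\<close> because the rectangle can be enlarged.

  For \<open>1 \<le> h \<le> 3/2\<close>, every pair of sides adds up to at most \<open>h\<close>. A sum above \<open>h + 1/2\<close> would make
  every side larger than \<open>1/2\<close>; then the vertical midline meets each square in a chord
  of at least \<open>4/5\<close> of its side, so that the sum is at most \<open>5 h / 4\<close>, a contradiction.

  All bounds are attained by axis-parallel squares.
\<close>

section \<open>Tilted squares in coordinates\<close>

text \<open>
  The parameters \<open>c\<close> and \<open>n\<close> stand for the cosine and the sine of the tilt. With them instead of an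
  angle, all estimates are polynomial inequalities subject to \<open>c\<^sup>2 + n\<^sup>2 = 1\<close>.
\<close>
definition sq :: "real \<Rightarrow> real \<Rightarrow> real \<Rightarrow> real \<Rightarrow> real \<Rightarrow> (real \<times> real) set" where
  "sq x y c n s = {(x + a * c - b * n, y + a * n + b * c) | a b. a \<in> {0..s} \<and> b \<in> {0..s}}"

lemma sqI:
  assumes "0 \<le> a" "a \<le> s" "0 \<le> b" "b \<le> s" "X = x + a * c - b * n" "Y = y + a * n + b * c"
  shows "(X, Y) \<in> sq x y c n s"
  using assms unfolding sq_def by fastforce

lemma sq_corners:
  assumes "s > 0"
  shows "(x, y) \<in> sq x y c n s" "(x + s * c, y + s * n) \<in> sq x y c n s"
    "(x - s * n, y + s * c) \<in> sq x y c n s"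
    "(x + s * c - s * n, y + s * n + s * c) \<in> sq x y c n s"
proof -
  show "(x, y) \<in> sq x y c n s" by (rule sqI[of 0 _ 0]) (use assms in auto)
  show "(x + s * c, y + s * n) \<in> sq x y c n s" by (rule sqI[of s _ 0]) (use assms in auto)
  show "(x - s * n, y + s * c) \<in> sq x y c n s" by (rule sqI[of 0 _ s]) (use assms in auto)
  show "(x + s * c - s * n, y + s * n + s * c) \<in> sq x y c n s"
    by (rule sqI[of s _ s]) (use assms in auto)
qed

lemma sq_quarter_turn: "sq x y c n s = sq (x + s * c) (y + s * n) (- n) c s"
proof (intro equalityI subsetI)
  fix p assume "p \<in> sq x y c n s"
  then obtain a b where "a \<in> {0..s}" "b \<in> {0..s}" "p = (x + a * c - b * n, y + a * n + b * c)"
    unfolding sq_def by blast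
  then show "p \<in> sq (x + s * c) (y + s * n) (- n) c s"
    by (auto intro!: sqI[of b _ "s - a"] simp: algebra_simps)
next
  fix p assume "p \<in> sq (x + s * c) (y + s * n) (- n) c s"
  then obtain a b where "a \<in> {0..s}" "b \<in> {0..s}"
      "p = (x + s * c + a * - n - b * c, y + s * n + a * c + b * - n)"
    unfolding sq_def by blast
  then show "p \<in> sq x y c n s"
    by (auto intro!: sqI[of "s - b" _ a] simp: algebra_simps)
qed

lemma is_square_sq:
  assumes "s > 0" "c\<^sup>2 + n\<^sup>2 = 1"
  shows "is_square (sq x y c n s) s"
  unfolding is_square_def
proof (intro conjI exI)
  show "norm (c, n) = 1" "norm (- n, c) = 1" using assms by (auto simp: norm_Pair add.commute)
  show "(c, n) \<bullet> (- n, c) = 0" by simp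
  show "sq x y c n s
      = {(x, y) + a *\<^sub>R (c, n) + b *\<^sub>R (- n, c) | a b. a \<in> {0..s} \<and> b \<in> {0..s}}"
    by (simp add: sq_def)
qed (use assms in auto)

lemma is_square_obtain_sq:
  assumes "is_square S s"
  obtains x y c n where "c\<^sup>2 + n\<^sup>2 = 1" "S = sq x y c n s"
proof -
  obtain C u v where uv: "norm u = 1" "norm v = 1" "u \<bullet> v = 0"
    and S: "S = {C + a *\<^sub>R u + b *\<^sub>R v | a b. a \<in> {0..s} \<and> b \<in> {0..s}}"
    using assms unfolding is_square_def by blast
  obtain x y where C: "C = (x, y)" by fastforce
  obtain c n where u: "u = (c, n)" by fastforce
  obtain v1 v2 where v: "v = (v1, v2)" by fastforce
  define k where "k = c * v2 - n * v1"
  have cn: "c\<^sup>2 + n\<^sup>2 = 1" and v12: "v1\<^sup>2 + v2\<^sup>2 = 1" and orth: "c * v1 + n * v2 = 0"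
    using uv by (auto simp: u v norm_Pair)
  have v1: "v1 = - n * k" and v2: "v2 = c * k"
    using cn orth unfolding k_def by algebra+
  have "k\<^sup>2 = 1" using cn v12 orth unfolding k_def by algebra
  then consider "k = 1" | "k = - 1" by (auto simp: power2_eq_1_iff)
  then show thesis
  proof cases
    case 1
    have "S = sq x y c n s"
      unfolding S sq_def C u v v1 v2 1 by simp
    with cn that show thesis by blast
  next
    case 2
    have "S = sq x y n (- c) s"
      unfolding S sq_def C u v v1 v2 2
      by (auto simp: algebra_simps) (smt (verit))+
    moreover have "n\<^sup>2 + (- c)\<^sup>2 = 1" using cn by simp
    ultimately show thesis using that by blast
  qed
qed

text \<open>
  Quarter turns of the side directions describe the same square from another corner. This
  normalizes the tilt to \<open>[0, \<pi>/2]\<close>, where the leftmost, lowest, rightmost and highest corners are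
  known.
\<close>
lemma is_square_quadrant:
  assumes "is_square S s"
  obtains x y c n where "c \<ge> 0" "n \<ge> 0" "c\<^sup>2 + n\<^sup>2 = 1" "S = sq x y c n s"
proof -
  define tilt where "tilt c n \<longleftrightarrow> c\<^sup>2 + n\<^sup>2 = 1 \<and> (\<exists>x y. S = sq x y c n s)" for c n
  have turn: "tilt (- n) c" if "tilt c n" for c n
    using that sq_quarter_turn[of _ _ c n s] unfolding tilt_def by fastforce
  obtain c n where t: "tilt c n"
    using is_square_obtain_sq[OF assms] unfolding tilt_def by metis
  have "\<exists>c n. c \<ge> 0 \<and> n \<ge> 0 \<and> tilt c n"
    using t turn[OF t] turn[OF turn[OF t]] turn[OF turn[OF turn[OF t]]]
    by (metis linear neg_0_le_iff_le minus_minus)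
  then show thesis using that unfolding tilt_def by blast
qed

text \<open>
  The alternative normalization of the tilt to \<open>[- \<pi>/4, \<pi>/4]\<close> makes the side that starts in the
  direction \<open>(c, n)\<close> from \<open>(x, y)\<close> the bottom side.
\<close>
lemma is_square_octant:
  assumes "is_square S s"
  obtains x y c n where "c > 0" "\<bar>n\<bar> \<le> c" "c\<^sup>2 + n\<^sup>2 = 1" "S = sq x y c n s"
proof -
  obtain x y c n where cn: "c \<ge> 0" "n \<ge> 0" "c\<^sup>2 + n\<^sup>2 = 1" and S: "S = sq x y c n s"
    using is_square_quadrant[OF assms] .
  show thesis
  proof (cases "n \<le> c")
    case True
    moreover from this have "c > 0" using cn by (cases "c = 0") auto
    ultimately show thesis using that[of c n x y] cn S by auto
  next
    case False
    have "S = sq (x - s * n) (y + s * c) n (- c) s"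
      using sq_quarter_turn[of "x - s * n" "y + s * c" n "- c" s] by (simp add: S)
    moreover have "n\<^sup>2 + (- c)\<^sup>2 = 1" using cn by simp
    ultimately show thesis using that[of n "- c"] False cn by auto
  qed
qed

definition hflip :: "(real \<times> real) set \<Rightarrow> (real \<times> real) set" where
  "hflip S = (\<lambda>(x, y). (1 - x, y)) ` S"

definition vflip :: "real \<Rightarrow> (real \<times> real) set \<Rightarrow> (real \<times> real) set" where
  "vflip h S = (\<lambda>(x, y). (x, h - y)) ` S"

lemma is_square_hflip:
  assumes "is_square S s"
  shows "is_square (hflip S) s"
proof -
  obtain x y c n where cn: "c\<^sup>2 + n\<^sup>2 = 1" and S: "S = sq x y c n s"
    using is_square_obtain_sq[OF assms] .
  have "hflip S = sq (1 - x) y n c s"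
  proof (intro equalityI subsetI)
    fix p assume "p \<in> hflip S"
    then obtain a b where "a \<in> {0..s}" "b \<in> {0..s}"
        "p = (1 - (x + a * c - b * n), y + a * n + b * c)"
      unfolding S sq_def hflip_def by fastforce
    then show "p \<in> sq (1 - x) y n c s" by (auto intro!: sqI[of b _ a])
  next
    fix p assume "p \<in> sq (1 - x) y n c s"
    then obtain a b where "a \<in> {0..s}" "b \<in> {0..s}" "p = (1 - x + a * n - b * c, y + a * c + b * n)"
      unfolding sq_def by blast
    then show "p \<in> hflip S" unfolding S hflip_def
      by (auto intro!: image_eqI[of _ _ "(1 - fst p, snd p)"] sqI[of b _ a])
  qed
  moreover have "n\<^sup>2 + c\<^sup>2 = 1" "s > 0" using cn assms by (auto simp: is_square_def)
  ultimately show ?thesis using is_square_sq by metis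
qed

lemma is_square_vflip:
  assumes "is_square S s"
  shows "is_square (vflip h S) s"
proof -
  obtain x y c n where cn: "c\<^sup>2 + n\<^sup>2 = 1" and S: "S = sq x y c n s"
    using is_square_obtain_sq[OF assms] .
  have "vflip h S = sq x (h - y) (- n) (- c) s"
  proof (intro equalityI subsetI)
    fix p assume "p \<in> vflip h S"
    then obtain a b where "a \<in> {0..s}" "b \<in> {0..s}"
        "p = (x + a * c - b * n, h - (y + a * n + b * c))"
      unfolding S sq_def vflip_def by fastforce
    then show "p \<in> sq x (h - y) (- n) (- c) s" by (auto intro!: sqI[of b _ a])
  next
    fix p assume "p \<in> sq x (h - y) (- n) (- c) s"
    then obtain a b where "a \<in> {0..s}" "b \<in> {0..s}"
        "p = (x + a * - n - b * - c, h - y + a * - c + b * - n)"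
      unfolding sq_def by blast
    then show "p \<in> vflip h S" unfolding S vflip_def
      by (auto intro!: image_eqI[of _ _ "(fst p, h - snd p)"] sqI[of b _ a])
  qed
  moreover have "(- n)\<^sup>2 + (- c)\<^sup>2 = 1" "s > 0" using cn assms by (auto simp: is_square_def)
  ultimately show ?thesis using is_square_sq by metis
qed

lemma quadrant_bounds:
  fixes c n :: real
  assumes "c \<ge> 0" "n \<ge> 0" "c\<^sup>2 + n\<^sup>2 = 1"
  shows "c \<le> 1" "n \<le> 1" "1 \<le> c + n" "c * n \<le> 1/2"
proof -
  have "c\<^sup>2 \<le> 1\<^sup>2" "n\<^sup>2 \<le> 1\<^sup>2"
    using assms(3) zero_le_power2[of c] zero_le_power2[of n] unfolding one_power2 by linarith+
  then show c: "c \<le> 1" and n: "n \<le> 1" by (blast intro: power2_le_imp_le zero_le_one)+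
  have "c\<^sup>2 \<le> c" "n\<^sup>2 \<le> n"
    using mult_left_le[OF c assms(1)] mult_left_le[OF n assms(2)] by (simp_all add: power2_eq_square)
  then show "1 \<le> c + n" using assms(3) by linarith
  have "0 \<le> (c - n)\<^sup>2" by simp
  then show "c * n \<le> 1/2" using assms(3) by (simp add: power2_diff)
qed

section \<open>Lines above and below a square\<close>

definition below :: "(real \<times> real) set \<Rightarrow> real \<Rightarrow> real \<Rightarrow> bool" where
  "below S \<beta> \<gamma> \<longleftrightarrow> (\<forall>(x, y)\<in>S. y \<le> \<beta> * x + \<gamma>)"

definition above :: "(real \<times> real) set \<Rightarrow> real \<Rightarrow> real \<Rightarrow> bool" where
  "above S \<beta> \<gamma> \<longleftrightarrow> (\<forall>(x, y)\<in>S. \<beta> * x + \<gamma> \<le> y)"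

lemma belowD: "below S \<beta> \<gamma> \<Longrightarrow> (x, y) \<in> S \<Longrightarrow> y \<le> \<beta> * x + \<gamma>"
  unfolding below_def by auto

lemma aboveD: "above S \<beta> \<gamma> \<Longrightarrow> (x, y) \<in> S \<Longrightarrow> \<beta> * x + \<gamma> \<le> y"
  unfolding above_def by auto

lemma hflip_below: "below S \<beta> \<gamma> \<Longrightarrow> below (hflip S) (- \<beta>) (\<beta> + \<gamma>)"
  by (auto simp: below_def hflip_def algebra_simps)

lemma hflip_above: "above S \<beta> \<gamma> \<Longrightarrow> above (hflip S) (- \<beta>) (\<beta> + \<gamma>)"
  by (auto simp: above_def hflip_def algebra_simps)

lemma vflip_below: "below S \<beta> \<gamma> \<Longrightarrow> above (vflip h S) (- \<beta>) (h - \<gamma>)"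
  by (auto simp: below_def above_def vflip_def algebra_simps)

lemma vflip_above: "above S \<beta> \<gamma> \<Longrightarrow> below (vflip h S) (- \<beta>) (h - \<gamma>)"
  by (auto simp: below_def above_def vflip_def algebra_simps)

lemma hflip_strip: "S \<subseteq> {0..1} \<times> A \<Longrightarrow> hflip S \<subseteq> {0..1} \<times> A"
  by (auto simp: hflip_def)

lemma convex_sq: "convex (sq x y c n s)"
proof -
  have "sq x y c n s = (+) (x, y) ` (\<lambda>(a, b). (a * c - b * n, a * n + b * c)) ` ({0..s} \<times> {0..s})"
    unfolding sq_def image_image by (force simp: image_def add_diff_eq add.assoc)
  moreover have "linear (\<lambda>(a, b). (a * c - b * n, a * n + b * c) :: real \<times> real)"
    by (rule linearI) (auto simp: algebra_simps)
  moreover have "convex ({0..s} \<times> {0..s})" by (intro convex_Times) auto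
  ultimately show ?thesis by (simp only: convex_linear_image convex_translation)
qed

lemma interior_sq_nonempty:
  assumes "s > 0" "c\<^sup>2 + n\<^sup>2 = 1"
  shows "interior (sq x y c n s) \<noteq> {}"
proof -
  define A where "A p = (fst p - x) * c + (snd p - y) * n" for p :: "real \<times> real"
  define B where "B p = (snd p - y) * c - (fst p - x) * n" for p :: "real \<times> real"
  let ?U = "{p. 0 < A p} \<inter> {p. A p < s} \<inter> {p. 0 < B p} \<inter> {p. B p < s}"
  have "open ?U"
    unfolding A_def B_def by (intro open_Int open_Collect_less continuous_intros)
  moreover have "?U \<subseteq> sq x y c n s"
  proof
    fix p assume p: "p \<in> ?U"
    have "fst p = x + A p * c - B p * n" "snd p = y + A p * n + B p * c"
      unfolding A_def B_def using assms(2) by algebra+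
    then have "(fst p, snd p) \<in> sq x y c n s"
      by (rule sqI[rotated 4]) (use p in auto)
    then show "p \<in> sq x y c n s" by simp
  qed
  moreover define h where "h = s / 2"
  have "(x + h * c - h * n, y + h * n + h * c) \<in> ?U" (is "?m \<in> _")
  proof -
    have "A ?m = h * (c\<^sup>2 + n\<^sup>2)" "B ?m = h * (c\<^sup>2 + n\<^sup>2)"
      unfolding A_def B_def fst_conv snd_conv by algebra+
    then show ?thesis using assms by (simp add: h_def)
  qed
  ultimately show ?thesis using interior_maximal by blast
qed

text \<open>
  The hyperplane theorem separates the disjoint interiors; the closed half-planes then contain the
  closures, hence the squares. The four cases are the possible directions of the normal vector.
\<close>
lemma separating_line:
  assumes S: "is_square S s" and T: "is_square T t" and disj: "interior S \<inter> interior T = {}"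
  shows "(\<exists>\<beta> \<gamma>. below S \<beta> \<gamma> \<and> above T \<beta> \<gamma>) \<or> (\<exists>\<beta> \<gamma>. below T \<beta> \<gamma> \<and> above S \<beta> \<gamma>) \<or>
    (\<exists>k. S \<subseteq> {..k} \<times> UNIV \<and> T \<subseteq> {k..} \<times> UNIV) \<or> (\<exists>k. T \<subseteq> {..k} \<times> UNIV \<and> S \<subseteq> {k..} \<times> UNIV)"
proof -
  have sq: "convex R \<and> interior R \<noteq> {}" if R: "is_square R r" for R r
    using is_square_obtain_sq[OF R] convex_sq interior_sq_nonempty R
    by (metis is_square_def)
  note conv = sq[OF S] sq[OF T]
  obtain a b where a: "a \<noteq> 0" and "\<forall>p\<in>interior S. a \<bullet> p \<le> b" "\<forall>p\<in>interior T. b \<le> a \<bullet> p"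
    using separating_hyperplane_sets[of "interior S" "interior T"] conv disj
    by (auto simp: convex_interior)
  then have "interior S \<subseteq> {p. a \<bullet> p \<le> b}" "interior T \<subseteq> {p. a \<bullet> p \<ge> b}" by blast+
  then have "closure (interior S) \<subseteq> {p. a \<bullet> p \<le> b}" "closure (interior T) \<subseteq> {p. a \<bullet> p \<ge> b}"
    using closure_minimal closed_halfspace_le closed_halfspace_ge by blast+
  then have "S \<subseteq> {p. a \<bullet> p \<le> b}" "T \<subseteq> {p. b \<le> a \<bullet> p}"
    using conv closure_subset[of S] closure_subset[of T] by (auto simp: convex_closure_interior)
  moreover obtain a1 a2 where a12: "a = (a1, a2)" by fastforce
  ultimately have le: "\<And>x y. (x, y) \<in> S \<Longrightarrow> a1 * x + a2 * y \<le> b"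
    and ge: "\<And>x y. (x, y) \<in> T \<Longrightarrow> b \<le> a1 * x + a2 * y" by fastforce+
  consider "a2 > 0" | "a2 < 0" | "a2 = 0" "a1 > 0" | "a2 = 0" "a1 < 0"
    using a a12 by (cases a2 "0::real" rule: linorder_cases; cases a1 "0::real" rule: linorder_cases)
      (auto simp: zero_prod_def)
  then show ?thesis
  proof cases
    case 1
    have "y \<le> - a1 / a2 * x + b / a2" if "(x, y) \<in> S" for x y
      using le[OF that] 1 by (simp add: field_simps)
    then have "below S (- a1 / a2) (b / a2)" unfolding below_def by blast
    moreover have "- a1 / a2 * x + b / a2 \<le> y" if "(x, y) \<in> T" for x y
      using ge[OF that] 1 by (simp add: field_simps)
    then have "above T (- a1 / a2) (b / a2)" unfolding above_def by blast
    ultimately show ?thesis by blast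
  next
    case 2
    have "y \<le> - a1 / a2 * x + b / a2" if "(x, y) \<in> T" for x y
      using ge[OF that] 2 by (simp add: field_simps)
    then have "below T (- a1 / a2) (b / a2)" unfolding below_def by blast
    moreover have "- a1 / a2 * x + b / a2 \<le> y" if "(x, y) \<in> S" for x y
      using le[OF that] 2 by (simp add: field_simps)
    then have "above S (- a1 / a2) (b / a2)" unfolding above_def by blast
    ultimately show ?thesis by blast
  next
    case 3
    have "x \<le> b / a1" if "(x, y) \<in> S" for x y
      using le[OF that] 3 by (simp add: field_simps)
    then have "S \<subseteq> {..b / a1} \<times> UNIV" by auto
    moreover have "b / a1 \<le> x" if "(x, y) \<in> T" for x y
      using ge[OF that] 3 by (simp add: field_simps)
    then have "T \<subseteq> {b / a1..} \<times> UNIV" by auto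
    ultimately show ?thesis by blast
  next
    case 4
    have "x \<le> b / a1" if "(x, y) \<in> T" for x y
      using ge[OF that] 4 by (simp add: field_simps)
    then have "T \<subseteq> {..b / a1} \<times> UNIV" by auto
    moreover have "b / a1 \<le> x" if "(x, y) \<in> S" for x y
      using le[OF that] 4 by (simp add: field_simps)
    then have "S \<subseteq> {b / a1..} \<times> UNIV" by auto
    ultimately show ?thesis by blast
  qed
qed

section \<open>Squares between two lines and a wall\<close>

lemma strip_side_le:
  assumes S: "is_square S s" "S \<subseteq> {k..l} \<times> UNIV"
  shows "s \<le> l - k"
proof -
  have s: "s > 0" using S by (simp add: is_square_def)
  obtain x y c n where cn: "c \<ge> 0" "n \<ge> 0" "c\<^sup>2 + n\<^sup>2 = 1" and Seq: "S = sq x y c n s"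
    using is_square_quadrant[OF S(1)] .
  note corner = sq_corners[OF s, where x = x and y = y and c = c and n = n, folded Seq]
  have "s * 1 \<le> s * (c + n)" using quadrant_bounds[OF cn] s by (intro mult_left_mono) auto
  moreover have "x + s * c \<le> l" "k \<le> x - s * n" using corner(2,3) S(2) by auto
  ultimately show ?thesis by (simp add: algebra_simps)
qed

text \<open>
  Three pairs of corners give three lower bounds for the vertical distance of the lines at the wall
  \<open>x = 0\<close>: highest and lowest corner, highest and rightmost corner, rightmost and lowest corner.
  The leftmost corner accounts for the wall. In every situation below one of the three bounds is
  strong enough.
\<close>
lemma wedge_supports:
  assumes S: "is_square S s" "S \<subseteq> {0..} \<times> UNIV"
    and lines: "above S \<beta>1 \<gamma>1" "below S \<beta>2 \<gamma>2" "\<beta>2 \<le> \<beta>1"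
  obtains c n where "c \<ge> 0" "n \<ge> 0" "c\<^sup>2 + n\<^sup>2 = 1"
    "s * (c + n - \<beta>2 * c + \<beta>1 * n) \<le> \<gamma>2 - \<gamma>1"
    "s * (c + (\<beta>1 - \<beta>2) * c + \<beta>1 * n) \<le> \<gamma>2 - \<gamma>1"
    "s * (n - \<beta>2 * c + (\<beta>1 - \<beta>2) * n) \<le> \<gamma>2 - \<gamma>1"
proof -
  have s: "s > 0" using S by (simp add: is_square_def)
  obtain x y c n where cn: "c \<ge> 0" "n \<ge> 0" "c\<^sup>2 + n\<^sup>2 = 1" and Seq: "S = sq x y c n s"
    using is_square_quadrant[OF S(1)] .
  note corner = sq_corners[OF s, where x = x and y = y and c = c and n = n, folded Seq]
  have wall: "s * n \<le> x" using corner(3) S(2) by auto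
  have D: "(\<beta>1 - \<beta>2) * (s * n) \<le> (\<beta>1 - \<beta>2) * x"
    using wall lines(3) by (intro mult_left_mono) auto
  note B = lines(2)[THEN belowD] and A = lines(1)[THEN aboveD]
  show thesis
  proof (rule that[of c n])
    show "s * (c + n - \<beta>2 * c + \<beta>1 * n) \<le> \<gamma>2 - \<gamma>1"
      using B[OF corner(4)] A[OF corner(1)] D by (simp add: algebra_simps)
    show "s * (c + (\<beta>1 - \<beta>2) * c + \<beta>1 * n) \<le> \<gamma>2 - \<gamma>1"
      using B[OF corner(4)] A[OF corner(2)] D by (simp add: algebra_simps)
    show "s * (n - \<beta>2 * c + (\<beta>1 - \<beta>2) * n) \<le> \<gamma>2 - \<gamma>1"
      using B[OF corner(2)] A[OF corner(1)] D by (simp add: algebra_simps)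
  qed (use cn in auto)
qed

text \<open>
  A square between two lines that approach each other to the right, touching the wall on the left,
  is largest when it is axis-parallel, as long as the slopes differ by at most 1. The restriction is
  genuine: among slopes \<open>1\<close> and \<open>- 1\<close> a square tilted by \<open>\<pi>/4\<close> is larger than an axis-parallel one can be.
\<close>
lemma square_le_vertical_gap:
  assumes S: "is_square S s" "S \<subseteq> {0..} \<times> UNIV"
    and lines: "above S \<beta>1 \<gamma>1" "below S \<beta>2 \<gamma>2" "\<beta>2 \<le> \<beta>1" "\<beta>1 - \<beta>2 \<le> 1"
  shows "s \<le> (\<beta>2 * s + \<gamma>2) - (\<beta>1 * s + \<gamma>1)"
proof -
  have s: "s > 0" using S by (simp add: is_square_def)
  obtain c n where cn: "c \<ge> 0" "n \<ge> 0" "c\<^sup>2 + n\<^sup>2 = 1"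
    and supp: "s * (c + n - \<beta>2 * c + \<beta>1 * n) \<le> \<gamma>2 - \<gamma>1"
    "s * (c + (\<beta>1 - \<beta>2) * c + \<beta>1 * n) \<le> \<gamma>2 - \<gamma>1"
    "s * (n - \<beta>2 * c + (\<beta>1 - \<beta>2) * n) \<le> \<gamma>2 - \<gamma>1"
    using wedge_supports[OF S lines(1-3)] .
  define D where "D = \<beta>1 - \<beta>2"
  have D: "0 \<le> D" "D \<le> 1" using lines by (auto simp: D_def)
  note q = quadrant_bounds[OF cn]
  have key: "\<exists>t\<in>{c + n - \<beta>2 * c + \<beta>1 * n, c + D * c + \<beta>1 * n, n - \<beta>2 * c + D * n}. 1 + D \<le> t"
  proof (cases "n \<le> c")
    case True
    show ?thesis
    proof (cases "1 + D \<le> c + D * c + \<beta>1 * n")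
      case False
      then have F: "\<beta>1 * n < (1 + D) * (1 - c)" by (simp add: algebra_simps)
      have n: "n > 0" 
      proof (rule ccontr)
        assume "\<not> n > 0"
        then have "n = 0" "c = 1" using cn by (auto simp: power2_eq_1_iff)
        then show False using F by simp
      qed
      \<comment> \<open>The second bound fails; feeding this into the first one multiplied by \<open>n\<close> leaves the surplus
        \<open>(1 - c) * (1 - D * c)\<close>, which is nonnegative because of \<open>D \<le> 1\<close>.\<close>
      have "(\<beta>1 * n) * (c - n) \<le> ((1 + D) * (1 - c)) * (c - n)"
        using F True by (intro mult_right_mono) auto
      moreover have "0 \<le> (1 - c) * (1 - D * c)"
        using q D mult_le_one[of D c] cn by simp
      moreover have "n * (c + n - 1 - \<beta>1 * (c - n) - D * (1 - c))
          = (1 - c) * (1 - D * c) + ((1 + D) * (1 - c)) * (c - n) - (\<beta>1 * n) * (c - n)"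
        using cn(3) by algebra
      ultimately have "0 \<le> n * (c + n - 1 - \<beta>1 * (c - n) - D * (1 - c))" by linarith
      then have "0 \<le> c + n - 1 - \<beta>1 * (c - n) - D * (1 - c)"
        using n by (simp add: zero_le_mult_iff)
      then have "1 + D \<le> c + n - \<beta>2 * c + \<beta>1 * n"
        unfolding D_def by (simp add: algebra_simps)
      then show ?thesis by blast
    qed blast
  next
    case nc: False
    show ?thesis
    proof (cases "1 + D \<le> n - \<beta>2 * c + D * n")
      case False
      then have F: "- \<beta>2 * c < (1 + D) * (1 - n)" by (simp add: algebra_simps)
      have c: "c > 0" 
      proof (rule ccontr)
        assume "\<not> c > 0"
        then have "c = 0" "n = 1" using cn by (auto simp: power2_eq_1_iff)
        then show False using F by simp
      qed
      \<comment> \<open>The mirror image of the previous case under reflection in a horizontal line, which swaps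
        \<open>c\<close> with \<open>n\<close> and \<open>\<beta>1\<close> with \<open>- \<beta>2\<close>.\<close>
      have "(- \<beta>2 * c) * (n - c) \<le> ((1 + D) * (1 - n)) * (n - c)"
        using F nc by (intro mult_right_mono) auto
      moreover have "0 \<le> (1 - n) * (1 - D * n)"
        using q D mult_le_one[of D n] cn by simp
      moreover have "c * (c + n - 1 + \<beta>2 * (n - c) - D * (1 - n))
          = (1 - n) * (1 - D * n) + ((1 + D) * (1 - n)) * (n - c) - (- \<beta>2 * c) * (n - c)"
        using cn(3) by algebra
      ultimately have "0 \<le> c * (c + n - 1 + \<beta>2 * (n - c) - D * (1 - n))" by linarith
      then have "0 \<le> c + n - 1 + \<beta>2 * (n - c) - D * (1 - n)"
        using c by (simp add: zero_le_mult_iff)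
      then have "1 + D \<le> c + n - \<beta>2 * c + \<beta>1 * n"
        unfolding D_def by (simp add: algebra_simps)
      then show ?thesis by blast
    qed blast
  qed
  then obtain t where t: "1 + D \<le> t" "s * t \<le> \<gamma>2 - \<gamma>1"
    using supp unfolding D_def[symmetric] by blast
  then have "s * (1 + D) \<le> \<gamma>2 - \<gamma>1"
    using mult_left_mono[OF t(1), of s] s by linarith
  then show ?thesis unfolding D_def by (simp add: algebra_simps)
qed

text \<open>
  If the lower line is a horizontal floor, the slope of the lid is arbitrary: this is the fact that the
  largest square in a right triangle has a corner at the right angle.
\<close>
lemma square_le_slanted_lid:
  assumes S: "is_square S s" "S \<subseteq> {0..} \<times> {k..}"
    and lid: "below S \<beta> \<gamma>" "\<beta> \<le> 0"
  shows "s \<le> (\<beta> * s + \<gamma>) - k"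
proof -
  have s: "s > 0" using S by (simp add: is_square_def)
  have strip: "S \<subseteq> {0..} \<times> UNIV" and floor: "above S 0 k"
    using S(2) by (auto simp: above_def)
  obtain c n where cn: "c \<ge> 0" "n \<ge> 0" "c\<^sup>2 + n\<^sup>2 = 1"
    and supp': "s * (c + n - \<beta> * c + 0 * n) \<le> \<gamma> - k"
      "s * (n - \<beta> * c + (0 - \<beta>) * n) \<le> \<gamma> - k"
    using wedge_supports[OF S(1) strip floor lid] .
  have supp: "s * (c + n - \<beta> * c) \<le> \<gamma> - k" "s * (n - \<beta> * c - \<beta> * n) \<le> \<gamma> - k"
    using supp' by simp_all
  note q = quadrant_bounds[OF cn]
  have "1 - \<beta> \<le> c + n - \<beta> * c \<or> 1 - \<beta> \<le> n - \<beta> * c - \<beta> * n"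
  proof (rule ccontr)
    assume "\<not> ?thesis"
    then have F: "c + n - 1 < - \<beta> * (1 - c)" "- \<beta> * (c + n - 1) < 1 - n"
      by (auto simp: algebra_simps)
    have c: "c < 1" using F(1) q by (cases "c = 1") auto
    have "(c + n - 1) * (c + n - 1) \<le> (- \<beta> * (1 - c)) * (c + n - 1)"
      using F(1) q by (intro mult_right_mono) auto
    also have "\<dots> = (- \<beta> * (c + n - 1)) * (1 - c)" by simp
    also have "\<dots> < (1 - n) * (1 - c)" using F(2) c by (intro mult_strict_right_mono) auto
    finally have "(c + n - 1) * (c + n - 1) < (1 - n) * (1 - c)" .
    moreover have "(c + n - 1) * (c + n - 1) = 2 * ((1 - n) * (1 - c))" using cn(3) by algebra
    moreover have "0 \<le> (1 - n) * (1 - c)" using q by simp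
    ultimately show False by linarith
  qed
  then have "s * (1 - \<beta>) \<le> \<gamma> - k"
    using supp s mult_left_mono[of "1 - \<beta>" "c + n - \<beta> * c" s]
      mult_left_mono[of "1 - \<beta>" "n - \<beta> * c - \<beta> * n" s] by linarith
  then show ?thesis by (simp add: algebra_simps)
qed

text \<open>
  A vertical chord of a tilted square near its rightmost corner cuts off a right triangle with
  hypotenuse \<open>\<kappa> s\<close> and altitude \<open>\<kappa> s c n\<close>, and the rightmost corner lies at least \<open>s (c + n)\<close> from
  the left wall. The chord at \<open>X'\<close> arises in the same way from the leftmost corner.
\<close>
lemma vertical_chords:
  assumes S: "is_square S s" "S \<subseteq> {0..1} \<times> UNIV" and \<kappa>: "0 \<le> \<kappa>" "\<kappa> \<le> 1"
  obtains c n X Y X' Y' where "c \<ge> 0" "n \<ge> 0" "c\<^sup>2 + n\<^sup>2 = 1" "s * (c + n) \<le> 1"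
    "(X, Y) \<in> S" "(X, Y + \<kappa> * s) \<in> S" "s * (c + n - \<kappa> * (c * n)) \<le> X"
    "(X', Y') \<in> S" "(X', Y' + \<kappa> * s) \<in> S" "X' \<le> 1 - s * (c + n - \<kappa> * (c * n))"
proof -
  have s: "s > 0" using S by (simp add: is_square_def)
  obtain x y c n where cn: "c \<ge> 0" "n \<ge> 0" "c\<^sup>2 + n\<^sup>2 = 1" and Seq: "S = sq x y c n s"
    using is_square_quadrant[OF S(1)] .
  note corner = sq_corners[OF s, where x = x and y = y and c = c and n = n, folded Seq]
  note q = quadrant_bounds[OF cn]
  have walls: "s * n \<le> x" "x + s * c \<le> 1" using corner(2,3) S(2) by auto
  have l: "\<kappa> * c \<le> 1" "\<kappa> * n \<le> 1" using mult_le_one[of \<kappa>] \<kappa> cn q by auto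
  have L: "s * (\<kappa> * c) \<le> s" "s * (\<kappa> * n) \<le> s" "0 \<le> s * (\<kappa> * c)" "0 \<le> s * (\<kappa> * n)"
    using mult_left_mono[OF l(1), of s] mult_left_mono[OF l(2), of s] s \<kappa> cn by auto
  show thesis
  proof (rule that[OF cn])
    show "s * (c + n) \<le> 1" using walls by (simp add: algebra_simps)
    show "(x + s * c - s * \<kappa> * (c * n), y + (s - s * (\<kappa> * n)) * n) \<in> S"
      unfolding Seq by (rule sqI[of "s - s * (\<kappa> * n)" _ 0]) (use L s in \<open>simp_all, algebra+\<close>)
    show "(x + s * c - s * \<kappa> * (c * n), y + (s - s * (\<kappa> * n)) * n + \<kappa> * s) \<in> S"
      unfolding Seq
    proof (rule sqI[of s _ "s * (\<kappa> * c)"])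
      show "y + (s - s * (\<kappa> * n)) * n + \<kappa> * s = y + s * n + s * (\<kappa> * c) * c"
        using cn(3) by algebra
    qed (use L s in \<open>simp_all\<close>)
    show "s * (c + n - \<kappa> * (c * n)) \<le> x + s * c - s * \<kappa> * (c * n)"
      using walls by (simp add: algebra_simps)
    show "(x - s * n + s * \<kappa> * (c * n), y + (s - s * (\<kappa> * c)) * c) \<in> S"
      unfolding Seq by (rule sqI[of 0 _ "s - s * (\<kappa> * c)"]) (use L s in \<open>simp_all, algebra+\<close>)
    show "(x - s * n + s * \<kappa> * (c * n), y + (s - s * (\<kappa> * c)) * c + \<kappa> * s) \<in> S"
      unfolding Seq
    proof (rule sqI[of "s * (\<kappa> * n)" _ s])
      show "y + (s - s * (\<kappa> * c)) * c + \<kappa> * s = y + s * (\<kappa> * n) * n + s * c"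
        using cn(3) by algebra
    qed (use L s in \<open>simp_all\<close>)
    show "x - s * n + s * \<kappa> * (c * n) \<le> 1 - s * (c + n - \<kappa> * (c * n))"
      using walls by (simp add: algebra_simps)
  qed
qed

section \<open>Anchored intervals of vertical lines\<close>

text \<open>
  A condition that is affine in the abscissa \<open>t\<close> of a vertical line in the strip holds on an interval that
  starts at one of the two walls; \<open>r\<close> is a lower bound for its length.
\<close>
definition anchored :: "real \<Rightarrow> (real \<Rightarrow> bool) \<Rightarrow> bool" where
  "anchored r P \<longleftrightarrow> (\<forall>t. 0 \<le> t \<and> t \<le> r \<longrightarrow> P t) \<or> (\<forall>t. 1 - r \<le> t \<and> t \<le> 1 \<longrightarrow> P t)"

lemma anchored_meet:
  assumes "anchored r P" "anchored r' Q" "0 \<le> r" "r \<le> 1" "0 \<le> r'" "r' \<le> 1" "1 \<le> r + r'"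
  obtains t where "P t" "Q t"
proof -
  have "\<exists>t\<in>{0, 1, r, r'}. P t \<and> Q t"
    using assms unfolding anchored_def by (smt (verit) insertCI)
  then show thesis using that by blast
qed

text \<open>
  Helly's theorem on the line: two of the three intervals start at the same wall, so the shorter of
  these, being met by the third one, provides the common point.
\<close>
lemma anchored_common:
  assumes "anchored r1 P1" "anchored r2 P2" "anchored r3 P3"
    and "0 \<le> r1" "r1 \<le> 1" "0 \<le> r2" "r2 \<le> 1" "0 \<le> r3" "r3 \<le> 1"
    and "1 \<le> r1 + r2" "1 \<le> r1 + r3" "1 \<le> r2 + r3"
  obtains t where "P1 t" "P2 t" "P3 t"
proof -
  have "\<exists>t\<in>{0, 1, r1, r2, r3, 1 - r1, 1 - r2, 1 - r3}. P1 t \<and> P2 t \<and> P3 t"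
    using assms(1-3) unfolding anchored_def
  proof (elim disjE)
  qed (use assms(4-) in \<open>auto\<close>)
  then show thesis using that by blast
qed

lemma anchored_downward:
  assumes "anchored r P" "0 \<le> r" "r \<le> 1" "\<And>t t'. t \<le> t' \<Longrightarrow> P t' \<Longrightarrow> P t"
  shows "P r"
  using assms(1) unfolding anchored_def
proof
  assume "\<forall>t. 1 - r \<le> t \<and> t \<le> 1 \<longrightarrow> P t"
  then have "P 1" using assms(2) by simp
  then show "P r" using assms(3,4) by blast
qed (use assms(2) in simp)

lemma anchored_upward:
  assumes "anchored r P" "0 \<le> r" "r \<le> 1" "\<And>t t'. t \<le> t' \<Longrightarrow> P t \<Longrightarrow> P t'"
  shows "P (1 - r)"
  using assms(1) unfolding anchored_def
proof
  assume "\<forall>t. 0 \<le> t \<and> t \<le> r \<longrightarrow> P t"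
  then have "P 0" using assms(2) by simp
  then show "P (1 - r)" using assms(3) assms(4)[of 0 "1 - r"] by simp
qed (use assms(2) in simp)

lemma bottom_anchored:
  assumes S: "is_square S s" "S \<subseteq> {0..1} \<times> {k..}" and lid: "below S \<beta> \<gamma>"
  shows "anchored s (\<lambda>t. s \<le> \<beta> * t + \<gamma> - k)"
proof (cases "\<beta> \<le> 0")
  case True
  have "s \<le> \<beta> * s + \<gamma> - k"
    by (rule square_le_slanted_lid) (use S lid True in auto)
  moreover have "\<beta> * s \<le> \<beta> * t" if "t \<le> s" for t
    using that True by (simp add: mult_left_mono_neg)
  ultimately show ?thesis unfolding anchored_def by fastforce
next
  case False
  have "s \<le> - \<beta> * s + (\<beta> + \<gamma>) - k"
  proof (rule square_le_slanted_lid)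
    show "is_square (hflip S) s" by (rule is_square_hflip[OF S(1)])
    show "hflip S \<subseteq> {0..} \<times> {k..}" using hflip_strip[OF S(2)] by auto
    show "below (hflip S) (- \<beta>) (\<beta> + \<gamma>)" by (rule hflip_below) fact
  qed (use False in simp)
  moreover have "\<beta> * (1 - s) \<le> \<beta> * t" if "1 - s \<le> t" for t
    using that False by (intro mult_left_mono) auto
  ultimately show ?thesis unfolding anchored_def by (fastforce simp: algebra_simps)
qed

lemma top_anchored:
  assumes S: "is_square S s" "S \<subseteq> {0..1} \<times> {..h}" and "above S \<beta> \<gamma>"
  shows "anchored s (\<lambda>t. s \<le> h - (\<beta> * t + \<gamma>))"
proof -
  have "anchored s (\<lambda>t. s \<le> - \<beta> * t + (h - \<gamma>) - 0)"
  proof (rule bottom_anchored)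
    show "is_square (vflip h S) s" by (rule is_square_vflip[OF S(1)])
    show "vflip h S \<subseteq> {0..1} \<times> {0..}" using S(2) by (auto simp: vflip_def)
    show "below (vflip h S) (- \<beta>) (h - \<gamma>)" by (rule vflip_above) fact
  qed
  then show ?thesis by (simp add: algebra_simps)
qed

lemma middle_anchored:
  assumes S: "is_square S s" "S \<subseteq> {0..1} \<times> UNIV"
    and lines: "above S \<beta>1 \<gamma>1" "below S \<beta>2 \<gamma>2" "\<bar>\<beta>1 - \<beta>2\<bar> \<le> 1"
  shows "anchored s (\<lambda>t. s \<le> (\<beta>2 * t + \<gamma>2) - (\<beta>1 * t + \<gamma>1))"
proof (cases "\<beta>2 \<le> \<beta>1")
  case True
  have "s \<le> (\<beta>2 * s + \<gamma>2) - (\<beta>1 * s + \<gamma>1)"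
    by (rule square_le_vertical_gap) (use S lines True in auto)
  moreover have "(\<beta>1 - \<beta>2) * t \<le> (\<beta>1 - \<beta>2) * s" if "t \<le> s" for t
    using that True by (intro mult_left_mono) auto
  ultimately show ?thesis unfolding anchored_def by (fastforce simp: algebra_simps)
next
  case False
  have "s \<le> (- \<beta>2 * s + (\<beta>2 + \<gamma>2)) - (- \<beta>1 * s + (\<beta>1 + \<gamma>1))"
  proof (rule square_le_vertical_gap)
    show "is_square (hflip S) s" by (rule is_square_hflip[OF S(1)])
    show "hflip S \<subseteq> {0..} \<times> UNIV" using hflip_strip[OF S(2)] by auto
    show "below (hflip S) (- \<beta>2) (\<beta>2 + \<gamma>2)" by (rule hflip_below) fact
    show "above (hflip S) (- \<beta>1) (\<beta>1 + \<gamma>1)" by (rule hflip_above) fact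
  qed (use False lines in auto)
  moreover have "(\<beta>2 - \<beta>1) * (1 - s) \<le> (\<beta>2 - \<beta>1) * t" if "1 - s \<le> t" for t
    using that False by (intro mult_left_mono) auto
  ultimately show ?thesis unfolding anchored_def by (fastforce simp: algebra_simps)
qed

lemma unit_chords:
  assumes S: "is_square S s" "S \<subseteq> {0..1} \<times> UNIV"
  obtains r X Y X' Y' where "9/10 * s \<le> r" "2 * s - 1 \<le> r" "r \<le> 1"
    "(X, Y) \<in> S" "(X, Y + s) \<in> S" "r \<le> X" "(X', Y') \<in> S" "(X', Y' + s) \<in> S" "X' \<le> 1 - r"
proof -
  have s: "s > 0" using S by (simp add: is_square_def)
  obtain c n X Y X' Y' where cn: "c \<ge> 0" "n \<ge> 0" "c\<^sup>2 + n\<^sup>2 = 1" and w: "s * (c + n) \<le> 1"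
    and XY: "(X, Y) \<in> S" "(X, Y + 1 * s) \<in> S" "s * (c + n - 1 * (c * n)) \<le> X"
    "(X', Y') \<in> S" "(X', Y' + 1 * s) \<in> S" "X' \<le> 1 - s * (c + n - 1 * (c * n))"
    using vertical_chords[OF S, of 1] by (metis order_refl zero_le_one)
  note q = quadrant_bounds[OF cn]
  have sqsum: "(c + n)\<^sup>2 = 1 + 2 * (c * n)" using cn(3) by algebra
  \<comment> \<open>A rational bound slightly above \<open>\<surd>2\<close>, the maximum of \<open>c + n\<close>.\<close>
  have "(c + n)\<^sup>2 \<le> (36/25)\<^sup>2" unfolding sqsum using q by (simp add: power2_eq_square)
  then have cn_le: "c + n \<le> 36/25" by (rule power2_le_imp_le) simp
  have f1: "9/10 \<le> c + n - c * n"
  proof -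
    have "(c + n - 1)\<^sup>2 \<le> (11/25)\<^sup>2" using q cn_le by (intro power_mono) auto
    moreover have "(c + n - 1)\<^sup>2 = 2 - 2 * (c + n - c * n)" using cn(3) by algebra
    ultimately have "2 - 2 * (c + n - c * n) \<le> (11/25)\<^sup>2" by metis
    then show ?thesis by (simp add: power2_eq_square)
  qed
  \<comment> \<open>The bound \<open>2 * s - 1\<close> uses that the width \<open>s * (c + n)\<close> is at most 1.\<close>
  have f2: "2 - (c + n) \<le> c + n - c * n"
  proof -
    have "(c + n - 1) * (c + n - 3) \<le> 0" using q cn_le by (simp add: mult_le_0_iff)
    then show ?thesis using sqsum by (simp add: power2_eq_square algebra_simps)
  qed
  show thesis
  proof (rule that[of "s * (c + n - c * n)" X Y X' Y'])
    show "9/10 * s \<le> s * (c + n - c * n)" using mult_left_mono[OF f1, of s] s by simp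
    show "2 * s - 1 \<le> s * (c + n - c * n)"
      using mult_left_mono[OF f2, of s] s w by (simp add: algebra_simps)
    have "s * (c + n - c * n) \<le> s * (c + n)" using s cn by (intro mult_left_mono) auto
    then show "s * (c + n - c * n) \<le> 1" using w by linarith
  qed (use XY in auto)
qed

text \<open>
  Without any condition on the slopes, a vertical chord of length \<open>s\<close> of the square itself bounds the
  gap of the lines from below. The two bounds on its position serve different purposes: \<open>9 s / 10\<close> is used
  if the square is smaller than a neighbour, \<open>2 s - 1\<close> if it is larger.
\<close>
lemma middle_anchored_chord:
  assumes S: "is_square S s" "S \<subseteq> {0..1} \<times> UNIV"
    and lines: "above S \<beta>1 \<gamma>1" "below S \<beta>2 \<gamma>2"
  obtains r where "9/10 * s \<le> r" "2 * s - 1 \<le> r" "r \<le> 1"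
    "anchored r (\<lambda>t. s \<le> (\<beta>2 * t + \<gamma>2) - (\<beta>1 * t + \<gamma>1))"
proof -
  obtain r X Y X' Y' where r: "9/10 * s \<le> r" "2 * s - 1 \<le> r" "r \<le> 1"
    and XY: "(X, Y) \<in> S" "(X, Y + s) \<in> S" "r \<le> X" "(X', Y') \<in> S" "(X', Y' + s) \<in> S" "X' \<le> 1 - r"
    using unit_chords[OF S] .
  have gap: "s \<le> (\<beta>2 * X + \<gamma>2) - (\<beta>1 * X + \<gamma>1)" "s \<le> (\<beta>2 * X' + \<gamma>2) - (\<beta>1 * X' + \<gamma>1)"
    using aboveD[OF lines(1) XY(1)] belowD[OF lines(2) XY(2)]
      aboveD[OF lines(1) XY(4)] belowD[OF lines(2) XY(5)] by linarith+
  have "anchored r (\<lambda>t. s \<le> (\<beta>2 * t + \<gamma>2) - (\<beta>1 * t + \<gamma>1))"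
  proof (cases "\<beta>2 \<le> \<beta>1")
    case True
    have "(\<beta>1 - \<beta>2) * t \<le> (\<beta>1 - \<beta>2) * X" if "t \<le> r" for t
      using that True XY(3) by (intro mult_left_mono) auto
    then show ?thesis unfolding anchored_def using gap(1) by (fastforce simp: algebra_simps)
  next
    case False
    have "(\<beta>2 - \<beta>1) * X' \<le> (\<beta>2 - \<beta>1) * t" if "1 - r \<le> t" for t
      using that False XY(6) by (intro mult_left_mono) auto
    then show ?thesis unfolding anchored_def using gap(2) by (fastforce simp: algebra_simps)
  qed
  with r that show thesis by blast
qed

section \<open>Two squares\<close>

definition stacked :: "(real \<times> real) set \<Rightarrow> (real \<times> real) set \<Rightarrow> bool" where
  "stacked S T \<longleftrightarrow> (\<exists>\<beta> \<gamma>. below S \<beta> \<gamma> \<and> above T \<beta> \<gamma>)"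

lemma stacked_if_wide:
  assumes S: "is_square S s" "S \<subseteq> {0..1} \<times> UNIV" and T: "is_square T t" "T \<subseteq> {0..1} \<times> UNIV"
    and disj: "interior S \<inter> interior T = {}" and wide: "1 < s + t"
  shows "stacked S T \<or> stacked T S"
proof -
  have side: "p + q \<le> 1"
    if "is_square P p" "P \<subseteq> {0..1} \<times> UNIV" "is_square Q q" "Q \<subseteq> {0..1} \<times> UNIV"
      "P \<subseteq> {..k} \<times> UNIV" "Q \<subseteq> {k..} \<times> UNIV" for P Q p q k
  proof -
    have "({0..1} \<times> UNIV) \<inter> ({..k} \<times> UNIV) \<subseteq> {0..k} \<times> UNIV"
      "({0..1} \<times> UNIV) \<inter> ({k..} \<times> UNIV) \<subseteq> {k..1} \<times> UNIV" by auto
    with that(2,4-6) have "P \<subseteq> {0..k} \<times> UNIV" "Q \<subseteq> {k..1} \<times> UNIV" by blast+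
    then show ?thesis using strip_side_le[OF that(1), of 0 k] strip_side_le[OF that(3), of k 1] by linarith
  qed
  have "\<not> s + t \<le> 1" "\<not> t + s \<le> 1" using wide by linarith+
  then have "\<not> (S \<subseteq> {..k} \<times> UNIV \<and> T \<subseteq> {k..} \<times> UNIV)" "\<not> (T \<subseteq> {..k} \<times> UNIV \<and> S \<subseteq> {k..} \<times> UNIV)" for k
    using side[OF S T, of k] side[OF T S, of k] by blast+
  then show ?thesis
    using separating_line[OF S(1) T(1) disj] unfolding stacked_def by blast
qed

text \<open>
  The intervals of the lower and of the upper square have total length at least 1, so they meet.
\<close>
lemma stacked_side_sum_le:
  assumes S: "is_square S s" "S \<subseteq> {0..1} \<times> {0..h}" and T: "is_square T t" "T \<subseteq> {0..1} \<times> {0..h}"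
    and stacked: "stacked S T" and wide: "1 \<le> s + t"
  shows "s + t \<le> h"
proof -
  obtain \<beta> \<gamma> where line: "below S \<beta> \<gamma>" "above T \<beta> \<gamma>" using stacked by (auto simp: stacked_def)
  have strip: "S \<subseteq> {0..1} \<times> {0..}" "T \<subseteq> {0..1} \<times> {..h}" "S \<subseteq> {0..1} \<times> UNIV" "T \<subseteq> {0..1} \<times> UNIV"
    using S(2) T(2) by auto
  have pos: "0 < s" "0 < t" using S(1) T(1) by (auto simp: is_square_def)
  have "s \<le> 1" "t \<le> 1" using strip_side_le[OF S(1) strip(3)] strip_side_le[OF T(1) strip(4)] by simp_all
  obtain \<tau> where "s \<le> \<beta> * \<tau> + \<gamma> - 0" "t \<le> h - (\<beta> * \<tau> + \<gamma>)"
    by (rule anchored_meet[OF bottom_anchored[OF S(1) strip(1) line(1)]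
          top_anchored[OF T(1) strip(2) line(2)]])
      (use that pos wide \<open>s \<le> 1\<close> \<open>t \<le> 1\<close> in \<open>simp_all\<close>)
  then show ?thesis by linarith
qed

text \<open>
  Squares whose sides add up to at most 1 satisfy the bound anyway; otherwise they are stacked.
\<close>
lemma two_square_side_sum_le:
  assumes S: "is_square S s" "S \<subseteq> {0..1} \<times> {0..h}" and T: "is_square T t" "T \<subseteq> {0..1} \<times> {0..h}"
    and disj: "interior S \<inter> interior T = {}" and h: "1 \<le> h"
  shows "s + t \<le> h"
proof (rule ccontr)
  assume "\<not> s + t \<le> h"
  then have wide: "1 < s + t" using h by linarith
  have "stacked S T \<or> stacked T S"
    by (rule stacked_if_wide) (use S T disj wide in auto)
  then have "s + t \<le> h"
    using stacked_side_sum_le[OF S T] stacked_side_sum_le[OF T S] wide by linarith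
  with \<open>\<not> s + t \<le> h\<close> show False by simp
qed

section \<open>Separating a small square from a large one by a shallow line\<close>

text \<open>
  A square of width \<open>q (c + \<bar>n\<bar>) \<le> 1\<close> whose side is close to 1 can tilt only a little: the tilt
  is of the order of \<open>1 - q\<close>, and the defect \<open>1 - c\<close> is of the order of its square.
\<close>
lemma large_square_tilt:
  assumes Q: "is_square Q q" "Q \<subseteq> {0..1} \<times> UNIV" and large: "10/11 < q"
  obtains x y c n where "Q = sq x y c n q" "c\<^sup>2 + n\<^sup>2 = 1" "0 < c" "\<bar>n\<bar> \<le> c / 5"
    "q * (1 - c) \<le> (1 - q) / 10" "0 \<le> x" "x + q * c \<le> 1"
proof -
  have q: "q > 0" using large by simp
  obtain x y c n where cn: "c > 0" "\<bar>n\<bar> \<le> c" "c\<^sup>2 + n\<^sup>2 = 1" and Qeq: "Q = sq x y c n q"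
    using is_square_octant[OF Q(1)] .
  note corner = sq_corners[OF q, where x = x and y = y and c = c and n = n, folded Qeq]
  have walls: "0 \<le> x" "q * n \<le> x" "x + q * c \<le> 1" "x + q * c - q * n \<le> 1"
    using corner Q(2) by auto
  define m where "m = \<bar>n\<bar>"
  have m: "0 \<le> m" "m \<le> c" and cm: "c\<^sup>2 + m\<^sup>2 = 1" using cn by (auto simp: m_def)
  have width: "q * (c + m) \<le> 1"
    using walls by (cases "n \<ge> 0") (auto simp: m_def algebra_simps)
  have "10/11 * (c + m) \<le> q * (c + m)" using large cn m by (intro mult_right_mono) auto
  then have cm_le: "c + m \<le> 11/10" using width by simp
  have "(c + m)\<^sup>2 \<le> (11/10)\<^sup>2" using cm_le cn m by (intro power_mono) auto
  moreover have "(c + m)\<^sup>2 = 1 + 2 * (c * m)" using cm by algebra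
  ultimately have "c * m \<le> 21/200" by (simp add: power2_eq_square)
  moreover have "m * m \<le> c * m" using m by (intro mult_right_mono) auto
  ultimately have "m * m \<le> 21/200" by linarith
  then have "(9/10)\<^sup>2 \<le> c\<^sup>2" using cm by (simp add: power2_eq_square)
  then have c: "9/10 \<le> c" using cn by (auto intro: power2_le_imp_le)
  have "9/10 * m \<le> c * m" using c m by (intro mult_right_mono) auto
  then have m_small: "m \<le> 3/25" using \<open>c * m \<le> 21/200\<close> by linarith
  have c1: "c \<le> 1" using quadrant_bounds(1)[of c m] cn(1) cm m by simp
  have "19 * (1 - c) \<le> 10 * ((1 - c) * (1 + c))"
    using mult_left_mono[of "19/10" "1 + c" "1 - c"] c c1 by simp
  also have "(1 - c) * (1 + c) = m * m" using cm by algebra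
  also have "10 * (m * m) \<le> 6/5 * m"
    using mult_right_mono[OF m_small m(1)] by simp
  finally have "10 * (1 - c) \<le> c + m - 1" using m(1) by argo
  then have "q * (10 * (1 - c)) \<le> q * (c + m - 1)" using q by (intro mult_left_mono) auto
  also have "\<dots> \<le> 1 - q" using width by (simp add: algebra_simps)
  finally have "q * (1 - c) \<le> (1 - q) / 10" by (simp add: algebra_simps)
  moreover have "\<bar>n\<bar> \<le> c / 5" using m_small c by (simp add: m_def)
  ultimately show thesis using that[of x y c n] Qeq cn walls by blast
qed

text \<open>
  If a line that descends steeply to the right separates \<open>P\<close> below from the large square \<open>Q\<close> above,
  then the line through the bottom side of \<open>Q\<close> already separates them. Otherwise \<open>P\<close> would
  reach above that line in the narrow gap between the left wall and \<open>Q\<close>. Then its topmost corner is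
  near the wall and hardly below the corner \<open>(x, y)\<close> of \<open>Q\<close>; since \<open>P\<close> is much wider than the
  gap, its upper side leads from there far to the right without descending much, and crosses the
  steep line.
\<close>
lemma steep_separator_below_large_square:
  assumes P: "is_square P p" "P \<subseteq> {0..1} \<times> UNIV" and Q: "is_square Q q" "Q \<subseteq> {0..1} \<times> UNIV"
    and line: "below P \<beta> \<gamma>" "above Q \<beta> \<gamma>" and steep: "\<beta> < - 1/3"
    and large: "10/11 < q" "1 - q < p / 10"
  shows "\<exists>\<sigma> \<kappa>. \<bar>\<sigma>\<bar> \<le> 1/3 \<and> below P \<sigma> \<kappa> \<and> above Q \<sigma> \<kappa>"
proof -
  have p: "p > 0" and q: "q > 0" using P Q by (auto simp: is_square_def)
  obtain x y c n where Qeq: "Q = sq x y c n q" and cn: "c\<^sup>2 + n\<^sup>2 = 1" "0 < c" "\<bar>n\<bar> \<le> c / 5"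
    and x: "q * (1 - c) \<le> (1 - q) / 10" "0 \<le> x" "x + q * c \<le> 1"
    using large_square_tilt[OF Q large(1)] .
  have x_le: "x \<le> 3/25 * p" using x large(2) by (simp add: algebra_simps)
  define \<sigma> where "\<sigma> = n / c"
  have \<sigma>: "\<bar>\<sigma>\<bar> \<le> 1/5" "n = \<sigma> * c" using cn by (auto simp: \<sigma>_def field_simps abs_if split: if_splits)
  have "above Q \<sigma> (y - \<sigma> * x)"
    unfolding above_def Qeq sq_def
  proof clarify
    fix a b assume "a \<in> {0..q}" "b \<in> {0..q}"
    then have ab: "0 \<le> b" by simp
    have "0 \<le> b * (c + \<sigma> * \<sigma> * c)" using ab cn by simp
    then show "\<sigma> * (x + a * c - b * n) + (y - \<sigma> * x) \<le> y + a * n + b * c"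
      unfolding \<sigma>(2) by (simp add: algebra_simps)
  qed
  moreover have "below P \<sigma> (y - \<sigma> * x)"
  proof (rule ccontr)
    assume "\<not> ?thesis"
    then obtain zx zy where z: "(zx, zy) \<in> P" and "\<sigma> * zx + (y - \<sigma> * x) < zy"
      unfolding below_def by force
    then have zy: "y + \<sigma> * (zx - x) < zy" by (simp add: algebra_simps)
    have "(x, y) \<in> Q" unfolding Qeq using sq_corners(1) q by simp
    then have below: "wy \<le> y + \<beta> * (wx - x)" if "(wx, wy) \<in> P" for wx wy
      using belowD[OF line(1) that] aboveD[OF line(2)] by (fastforce simp: algebra_simps)
    have zx: "zx < x"
    proof (rule ccontr)
      assume "\<not> zx < x"
      then have "\<beta> * (zx - x) \<le> \<sigma> * (zx - x)"
        using steep \<sigma> by (intro mult_right_mono) auto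
      then show False using below[OF z] zy by linarith
    qed
    have zx0: "0 \<le> zx" using z P(2) by auto
    have "- (1/5) * x \<le> \<sigma> * (zx - x)"
    proof -
      have "\<sigma> * (x - zx) \<le> 1/5 * (x - zx)" using \<sigma> zx by (intro mult_right_mono) auto
      then show ?thesis using zx0 by (simp add: algebra_simps)
    qed
    then have zy': "y - x / 5 < zy" using zy by simp
    have top: "kx < 8/5 * x" if k: "(kx, ky) \<in> P" "zy \<le> ky" for kx ky
    proof (cases "kx \<le> x")
      case False
      then have "\<beta> * (kx - x) \<le> - (1/3) * (kx - x)" using steep by (intro mult_right_mono) auto
      then show ?thesis using below[OF k(1)] k(2) zy' by argo
    qed (use zx zx0 in simp)
    obtain u v d l where dl: "d > 0" "\<bar>l\<bar> \<le> d" "d\<^sup>2 + l\<^sup>2 = 1" and Peq: "P = sq u v d l p"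
      using is_square_octant[OF P(1)] .
    note corner = sq_corners[OF p, where x = u and y = v and c = d and n = l, folded Peq]
    have walls: "0 \<le> u" "0 \<le> u - p * l" using corner P(2) by auto
    obtain a b where ab: "0 \<le> a" "a \<le> p" "0 \<le> b" "b \<le> p" and zab: "zy = v + a * l + b * d"
      using z unfolding Peq sq_def by auto
    have bd: "b * d \<le> p * d" using ab dl by (intro mult_right_mono) auto
    \<comment> \<open>A counterclockwise tilt puts the topmost corner far from the wall. A clockwise tilt must be
      small, and then the next corner lies too far to the right.\<close>
    show False
    proof (cases "l \<ge> 0")
      case True
      have "a * l \<le> p * l" using ab True by (intro mult_right_mono) auto
      then have "u + p * d - p * l < 8/5 * x" using top[OF corner(4)] zab bd by simp
      moreover have "p * (1/2) \<le> p * d"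
      proof -
        have "l\<^sup>2 \<le> d\<^sup>2" using dl True by (intro power_mono) auto
        then have "(1/2)\<^sup>2 \<le> d\<^sup>2" using dl(3) by (simp add: power2_eq_square)
        then have "1/2 \<le> d" using dl(1) by (auto intro: power2_le_imp_le)
        then show ?thesis using p by (intro mult_left_mono) auto
      qed
      ultimately show False using walls x_le p by linarith
    next
      case False
      have "a * l \<le> 0" using ab False by (simp add: mult_le_0_iff)
      then have zk: "zy \<le> v + p * d" using zab bd by simp
      have "u - p * l < 8/5 * x" using top[OF corner(3) zk] .
      then have pl: "- (p * l) < 8/5 * x" using walls by linarith
      then have "p * (- l) < p * (1/5)" using x_le p by (simp add: algebra_simps)
      then have "- l < 1/5" using p by (simp only: mult_less_cancel_left_pos)
      then have "l\<^sup>2 \<le> (1/5)\<^sup>2" using False by (intro power2_le_iff_abs_le[THEN iffD2]) auto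
      then have "(9/10)\<^sup>2 \<le> d\<^sup>2" using dl(3) by (simp add: power2_eq_square)
      then have "9/10 \<le> d" using dl(1) by (auto intro: power2_le_imp_le)
      then have pd: "p * (9/10) \<le> p * d" using p by (intro mult_left_mono) auto
      then have "\<beta> * (u + p * d - p * l - x) \<le> - (1/3) * (u + p * d - p * l - x)"
      proof (intro mult_right_mono)
        show "0 \<le> u + p * d - p * l - x" using pd walls x_le p by linarith
      qed (use steep in simp)
      then show False
        using below[OF corner(4)] zk zy' pl walls pd x_le p by argo
    qed
  qed
  moreover have "\<bar>\<sigma>\<bar> \<le> 1/3" using \<sigma> by linarith
  ultimately show ?thesis by blast
qed

lemma shallow_separator_below_large_square:
  assumes P: "is_square P p" "P \<subseteq> {0..1} \<times> UNIV" and Q: "is_square Q q" "Q \<subseteq> {0..1} \<times> UNIV"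
    and line: "below P \<beta> \<gamma>" "above Q \<beta> \<gamma>"
    and large: "10/11 < q" "1 - q < p / 10"
  shows "\<exists>\<sigma> \<kappa>. \<bar>\<sigma>\<bar> \<le> 1/3 \<and> below P \<sigma> \<kappa> \<and> above Q \<sigma> \<kappa>"
proof -
  consider "\<bar>\<beta>\<bar> \<le> 1/3" | "\<beta> < - 1/3" | "- \<beta> < - 1/3" by linarith
  then show ?thesis
  proof cases
    case 1 then show ?thesis using line by blast
  next
    case 2 then show ?thesis using steep_separator_below_large_square[OF P Q line] large by blast
  next
    case 3
    have "is_square (hflip P) p" "is_square (hflip Q) q"
      using is_square_hflip P(1) Q(1) by blast+
    then obtain \<sigma> \<kappa> where \<sigma>: "\<bar>\<sigma>\<bar> \<le> 1/3" "below (hflip P) \<sigma> \<kappa>" "above (hflip Q) \<sigma> \<kappa>"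
      using steep_separator_below_large_square hflip_strip[OF P(2)] hflip_strip[OF Q(2)]
        hflip_below[OF line(1)] hflip_above[OF line(2)] 3 large by blast
    have "hflip (hflip R) = R" for R by (force simp: hflip_def)
    then have "below P (- \<sigma>) (\<sigma> + \<kappa>)" "above Q (- \<sigma>) (\<sigma> + \<kappa>)"
      using hflip_below[OF \<sigma>(2)] hflip_above[OF \<sigma>(3)] by simp_all
    then show ?thesis using \<sigma>(1) by (metis abs_minus_cancel)
  qed
qed

text \<open>
  Both bottom corners of the large square are at height at most \<open>h - q c\<close>, and the line can rise only
  over the short distance from a bottom corner to the wall.
\<close>
lemma shallow_line_below_large_square:
  assumes Q: "is_square Q q" "Q \<subseteq> {0..1} \<times> {..h}" and large: "10/11 < q"
    and line: "above Q \<sigma> \<kappa>" "\<bar>\<sigma>\<bar> \<le> 1/3" and t: "0 \<le> t" "t \<le> 1"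
  shows "\<sigma> * t + \<kappa> \<le> h - q + 2/3 * (1 - q)"
proof -
  have q: "q > 0" using large by simp
  have strip: "Q \<subseteq> {0..1} \<times> UNIV" using Q(2) by auto
  obtain x y c n where Qeq: "Q = sq x y c n q" and cn: "c\<^sup>2 + n\<^sup>2 = 1" "0 < c" "\<bar>n\<bar> \<le> c / 5"
    and x: "q * (1 - c) \<le> (1 - q) / 10" "0 \<le> x" "x + q * c \<le> 1"
    using large_square_tilt[OF Q(1) strip large] .
  note corner = sq_corners[OF q, where x = x and y = y and c = c and n = n, folded Qeq]
  have "y + q * c \<le> h" "y + q * n + q * c \<le> h" using corner(3,4) Q(2) by auto
  then have ends: "\<sigma> * x + \<kappa> \<le> h - q * c" "\<sigma> * (x + q * c) + \<kappa> \<le> h - q * c"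
    using aboveD[OF line(1) corner(1)] aboveD[OF line(1) corner(2)] by linarith+
  have slope: "\<sigma> * d \<le> 1/3 * \<bar>d\<bar>" for d
    using mult_right_mono[OF line(2), of "\<bar>d\<bar>"] abs_ge_self[of "\<sigma> * d"] by (simp add: abs_mult)
  have "3 * (\<sigma> * t + \<kappa>) \<le> 3 * (h - q * c) + (1 - q * c)"
  proof (cases "\<sigma> \<ge> 0")
    case True
    then have "\<sigma> * t \<le> \<sigma> * 1" using t by (intro mult_left_mono) auto
    moreover have "3 * (\<sigma> * (1 - x - q * c)) \<le> 1 - x - q * c"
      using slope[of "1 - x - q * c"] x by simp
    ultimately show ?thesis using ends(2) x(2) by (simp add: algebra_simps)
  next
    case False
    then have "\<sigma> * t \<le> 0" using t by (simp add: mult_le_0_iff)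
    moreover have "3 * (\<sigma> * (- x)) \<le> x" using slope[of "- x"] x by simp
    ultimately show ?thesis using ends(1) x(2,3) by (simp add: algebra_simps)
  qed
  moreover have "q \<le> 1" using strip_side_le[OF Q(1) strip] by simp
  moreover have "10 * q - 10 * (q * c) \<le> 1 - q" using x(1) by (simp add: algebra_simps)
  ultimately show ?thesis by argo
qed

section \<open>Three stacked squares in a tall rectangle\<close>

text \<open>
  The case of a top square so large that the chord of the middle square does not suffice. If the lower
  separating line is steep, the upper one is replaced by a horizontal line at height
  \<open>H = h - t + 2/3 (1 - t)\<close>. The intervals of the two lower squares overlap by \<open>b + m - 1\<close>, which exceeds
  \<open>1 - t\<close>; moving along the steep line by that much gains at least
  the \<open>2/3 (1 - t)\<close> that were lost.
\<close>
lemma stack_below_large_square: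
  assumes B: "is_square B b" "B \<subseteq> {0..1} \<times> {0..h}" and M: "is_square M m" "M \<subseteq> {0..1} \<times> {0..h}"
    and T: "is_square T t" "T \<subseteq> {0..1} \<times> {0..h}"
    and stack: "stacked B M" "stacked M T" and h: "2 \<le> h" and large: "m < t" "1 - t < m / 10"
  shows "b + m + t \<le> h"
proof (rule ccontr)
  assume "\<not> ?thesis"
  then have sum: "h < b + m + t" by simp
  have strip: "B \<subseteq> {0..1} \<times> UNIV" "M \<subseteq> {0..1} \<times> UNIV" "T \<subseteq> {0..1} \<times> UNIV"
    "B \<subseteq> {0..1} \<times> {0..}" "T \<subseteq> {0..1} \<times> {..h}"
    using B(2) M(2) T(2) by auto
  have pos: "0 < b" "0 < m" "0 < t" using B M T by (auto simp: is_square_def)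
  have le1: "b \<le> 1" "m \<le> 1" "t \<le> 1"
    using strip_side_le[OF B(1) strip(1)] strip_side_le[OF M(1) strip(2)]
      strip_side_le[OF T(1) strip(3)] by simp_all
  have t: "10/11 < t" using large by argo
  obtain \<beta> \<gamma> where bm: "below B \<beta> \<gamma>" "above M \<beta> \<gamma>" using stack by (auto simp: stacked_def)
  obtain \<beta>' \<gamma>' where "below M \<beta>' \<gamma>'" "above T \<beta>' \<gamma>'" using stack by (auto simp: stacked_def)
  then obtain \<sigma> \<kappa> where \<sigma>: "\<bar>\<sigma>\<bar> \<le> 1/3" "below M \<sigma> \<kappa>" "above T \<sigma> \<kappa>"
    using shallow_separator_below_large_square[OF M(1) strip(2) T(1) strip(3) _ _ t large(2)] by blast
  have bottom: "anchored b (\<lambda>\<tau>. b \<le> \<beta> * \<tau> + \<gamma> - 0)"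
    by (rule bottom_anchored[OF B(1) strip(4) bm(1)])
  show False
  proof (cases "\<bar>\<beta>\<bar> \<le> 2/3")
    case True
    then have "\<bar>\<beta> - \<sigma>\<bar> \<le> 1" using \<sigma>(1) by linarith
    note middle = middle_anchored[OF M(1) strip(2) bm(2) \<sigma>(2) this]
    note top = top_anchored[OF T(1) strip(5) \<sigma>(3)]
    obtain \<tau> where "b \<le> \<beta> * \<tau> + \<gamma> - 0" "m \<le> \<sigma> * \<tau> + \<kappa> - (\<beta> * \<tau> + \<gamma>)" "t \<le> h - (\<sigma> * \<tau> + \<kappa>)"
      by (rule anchored_common[OF bottom middle top]) (use pos le1 sum h in auto)
    then show False using sum by linarith
  next
    case False
    define H where "H = h - t + 2/3 * (1 - t)"
    have "x \<in> {0..1} \<and> y \<in> {..H}" if xy: "(x, y) \<in> M" for x y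
    proof -
      have x: "x \<in> {0..1}" using M(2) xy by auto
      have "\<sigma> * x + \<kappa> \<le> H"
        unfolding H_def using shallow_line_below_large_square[OF T(1) strip(5) t \<sigma>(3,1)] x by simp
      then show ?thesis using belowD[OF \<sigma>(2) xy] x by simp
    qed
    then have "M \<subseteq> {0..1} \<times> {..H}" by auto
    note middle = top_anchored[OF M(1) this bm(2)]
    have wide: "0 \<le> b + m - 1" using sum h le1 by linarith
    have "b + m \<le> H - \<bar>\<beta>\<bar> * (b + m - 1)"
    proof (cases "\<beta> \<ge> 0")
      case True
      have mono: "\<beta> * \<tau> \<le> \<beta> * \<tau>'" if "\<tau> \<le> \<tau>'" for \<tau> \<tau>' using that True by (rule mult_left_mono)
      have "b \<le> \<beta> * (1 - b) + \<gamma> - 0"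
        by (rule anchored_upward[OF bottom]) (use pos le1 in \<open>auto dest: mono\<close>)
      moreover have "m \<le> H - (\<beta> * m + \<gamma>)"
        by (rule anchored_downward[OF middle]) (use pos le1 in \<open>auto dest: mono\<close>)
      ultimately show ?thesis using True by (simp add: algebra_simps)
    next
      case False
      have mono: "\<beta> * \<tau>' \<le> \<beta> * \<tau>" if "\<tau> \<le> \<tau>'" for \<tau> \<tau>'
        using that False by (intro mult_left_mono_neg) auto
      have "b \<le> \<beta> * b + \<gamma> - 0"
        by (rule anchored_downward[OF bottom]) (use pos le1 in \<open>auto dest: mono\<close>)
      moreover have "m \<le> H - (\<beta> * (1 - m) + \<gamma>)"
        by (rule anchored_upward[OF middle]) (use pos le1 in \<open>auto dest: mono\<close>)
      ultimately show ?thesis using False by (simp add: algebra_simps)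
    qed
    moreover have "2/3 * (b + m - 1) \<le> \<bar>\<beta>\<bar> * (b + m - 1)"
      using False wide by (intro mult_right_mono) auto
    ultimately have "b + m \<le> H - 2/3 * (b + m - 1)" by argo
    then show False using sum h unfolding H_def by argo
  qed
qed

text \<open>
  An end square that is not larger than the middle one, or falls short of the full width by at least
  \<open>m / 10\<close>, leaves the other two sides a surplus over 1 that makes up for the length missing from the
  middle interval. The remaining case is the one of a large end square, up to a reflection.
\<close>
lemma three_stacked_side_sum_le:
  assumes B: "is_square B b" "B \<subseteq> {0..1} \<times> {0..h}" and M: "is_square M m" "M \<subseteq> {0..1} \<times> {0..h}"
    and T: "is_square T t" "T \<subseteq> {0..1} \<times> {0..h}"
    and stack: "stacked B M" "stacked M T" and h: "2 \<le> h"
  shows "b + m + t \<le> h"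
proof (rule ccontr)
  assume "\<not> ?thesis"
  then have sum: "h < b + m + t" by simp
  have strip: "B \<subseteq> {0..1} \<times> UNIV" "M \<subseteq> {0..1} \<times> UNIV" "T \<subseteq> {0..1} \<times> UNIV"
    "B \<subseteq> {0..1} \<times> {0..}" "T \<subseteq> {0..1} \<times> {..h}"
    using B(2) M(2) T(2) by auto
  have pos: "0 < b" "0 < m" "0 < t" using B M T by (auto simp: is_square_def)
  have le1: "b \<le> 1" "m \<le> 1" "t \<le> 1"
    using strip_side_le[OF B(1) strip(1)] strip_side_le[OF M(1) strip(2)]
      strip_side_le[OF T(1) strip(3)] by simp_all
  have top: "t \<le> m \<or> m / 10 \<le> 1 - t"
    using stack_below_large_square[OF B M T stack h] sum by linarith
  have bottom: "b \<le> m \<or> m / 10 \<le> 1 - b"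
  proof -
    have sq: "is_square (vflip h R) r" if "is_square R r" for R r using is_square_vflip[OF that] .
    have sub: "vflip h R \<subseteq> {0..1} \<times> {0..h}" if "R \<subseteq> {0..1} \<times> {0..h}" for R
      using that by (auto simp: vflip_def)
    have st: "stacked (vflip h R') (vflip h R)" if "stacked R R'" for R R'
      using that vflip_below vflip_above unfolding stacked_def by blast
    have "t + m + b \<le> h" if "m < b" "1 - b < m / 10"
      using stack_below_large_square[OF sq[OF T(1)] sub[OF T(2)] sq[OF M(1)] sub[OF M(2)]
          sq[OF B(1)] sub[OF B(2)] st[OF stack(2)] st[OF stack(1)] h that] .
    then show ?thesis using sum by linarith
  qed
  obtain \<beta> \<gamma> where bm: "below B \<beta> \<gamma>" "above M \<beta> \<gamma>" using stack by (auto simp: stacked_def)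
  obtain \<sigma> \<kappa> where mt: "below M \<sigma> \<kappa>" "above T \<sigma> \<kappa>" using stack by (auto simp: stacked_def)
  obtain r where r: "9/10 * m \<le> r" "2 * m - 1 \<le> r" "r \<le> 1"
    and middle: "anchored r (\<lambda>\<tau>. m \<le> \<sigma> * \<tau> + \<kappa> - (\<beta> * \<tau> + \<gamma>))"
    using middle_anchored_chord[OF M(1) strip(2) bm(2) mt(1)] .
  have "1 \<le> b + r" using top r(1,2) sum h by argo
  moreover have "1 \<le> r + t" using bottom r(1,2) sum h by argo
  moreover have "1 \<le> b + t" using le1 sum h by argo
  moreover have "0 \<le> r" using r(1) pos by argo
  ultimately obtain \<tau> where
    "b \<le> \<beta> * \<tau> + \<gamma> - 0" "m \<le> \<sigma> * \<tau> + \<kappa> - (\<beta> * \<tau> + \<gamma>)" "t \<le> h - (\<sigma> * \<tau> + \<kappa>)"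
    by - (rule anchored_common[OF bottom_anchored[OF B(1) strip(4) bm(1)] middle
          top_anchored[OF T(1) strip(5) mt(2)]], use pos le1 r(3) in auto)
  then show False using sum by linarith
qed

text \<open>
  If the bound fails, all pairs of sides add up to more than 1, so all pairs are stacked. Stacking is then a tournament on three
  vertices, and every tournament contains a directed path through all its vertices.
\<close>
lemma three_squares_tall:
  assumes sq: "is_square S0 s0" "is_square S1 s1" "is_square S2 s2"
    and sub: "S0 \<subseteq> {0..1} \<times> {0..h}" "S1 \<subseteq> {0..1} \<times> {0..h}" "S2 \<subseteq> {0..1} \<times> {0..h}"
    and disj: "interior S0 \<inter> interior S1 = {}" "interior S0 \<inter> interior S2 = {}"
      "interior S1 \<inter> interior S2 = {}"
    and h: "2 \<le> h"
  shows "s0 + s1 + s2 \<le> h"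
proof (rule ccontr)
  assume "\<not> ?thesis"
  then have sum: "h < s0 + s1 + s2" by simp
  have strip: "S0 \<subseteq> {0..1} \<times> UNIV" "S1 \<subseteq> {0..1} \<times> UNIV" "S2 \<subseteq> {0..1} \<times> UNIV"
    using sub by auto
  have le1: "s0 \<le> 1" "s1 \<le> 1" "s2 \<le> 1"
    using strip_side_le[OF sq(1) strip(1)] strip_side_le[OF sq(2) strip(2)]
      strip_side_le[OF sq(3) strip(3)] by simp_all
  have wide: "1 < s0 + s1" "1 < s0 + s2" "1 < s1 + s2" using sum h le1 by linarith+
  have "stacked S0 S1 \<or> stacked S1 S0"
    using stacked_if_wide[OF sq(1) strip(1) sq(2) strip(2) disj(1) wide(1)] .
  moreover have "stacked S0 S2 \<or> stacked S2 S0"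
    using stacked_if_wide[OF sq(1) strip(1) sq(3) strip(3) disj(2) wide(2)] .
  moreover have "stacked S1 S2 \<or> stacked S2 S1"
    using stacked_if_wide[OF sq(2) strip(2) sq(3) strip(3) disj(3) wide(3)] .
  ultimately consider "stacked S0 S1" "stacked S1 S2" | "stacked S0 S2" "stacked S2 S1"
    | "stacked S1 S0" "stacked S0 S2" | "stacked S1 S2" "stacked S2 S0"
    | "stacked S2 S0" "stacked S0 S1" | "stacked S2 S1" "stacked S1 S0" by blast
  then show False
  proof cases
    case 1
    from three_stacked_side_sum_le[OF sq(1) sub(1) sq(2) sub(2) sq(3) sub(3) this h] sum
    show False by linarith
  next
    case 2
    from three_stacked_side_sum_le[OF sq(1) sub(1) sq(3) sub(3) sq(2) sub(2) this h] sum
    show False by linarith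
  next
    case 3
    from three_stacked_side_sum_le[OF sq(2) sub(2) sq(1) sub(1) sq(3) sub(3) this h] sum
    show False by linarith
  next
    case 4
    from three_stacked_side_sum_le[OF sq(2) sub(2) sq(3) sub(3) sq(1) sub(1) this h] sum
    show False by linarith
  next
    case 5
    from three_stacked_side_sum_le[OF sq(3) sub(3) sq(1) sub(1) sq(2) sub(2) this h] sum
    show False by linarith
  next
    case 6
    from three_stacked_side_sum_le[OF sq(3) sub(3) sq(2) sub(2) sq(1) sub(1) this h] sum
    show False by linarith
  qed
qed

section \<open>Three squares in a short rectangle\<close>

text \<open>
  Chords of length \<open>4 s / 5\<close> occur on both sides of the midline, hence by convexity on it.
  The factor \<open>4/5\<close> is below \<open>2 / (1 + \<surd>2)\<close>, the largest factor for which a square with tilt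
  \<open>\<pi>/4\<close> has such a chord at distance \<open>s\<close> from the wall that it touches.
\<close>
lemma midline_chord:
  assumes S: "is_square S s" "S \<subseteq> {0..1} \<times> {0..h}" and s: "1/2 < s"
  obtains z where "0 \<le> z" "z + 4/5 * s \<le> h" "(1/2, z) \<in> S" "(1/2, z + 4/5 * s) \<in> S"
proof -
  have strip: "S \<subseteq> {0..1} \<times> UNIV" using S(2) by auto
  have \<kappa>: "0 \<le> (4/5 :: real)" "(4/5 :: real) \<le> 1" by simp_all
  obtain c n X Y X' Y' where cn: "c \<ge> 0" "n \<ge> 0" "c\<^sup>2 + n\<^sup>2 = 1" and w: "s * (c + n) \<le> 1"
    and X: "(X, Y) \<in> S" "(X, Y + 4/5 * s) \<in> S" "s * (c + n - 4/5 * (c * n)) \<le> X"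
    and X': "(X', Y') \<in> S" "(X', Y' + 4/5 * s) \<in> S" "X' \<le> 1 - s * (c + n - 4/5 * (c * n))"
    using vertical_chords[OF S(1) strip \<kappa>] .
  note q = quadrant_bounds[OF cn]
  have "1 \<le> c + n - 4/5 * (c * n)"
  proof -
    have "(c + n)\<^sup>2 \<le> (3/2)\<^sup>2"
      using q cn(3) by (simp add: power2_sum) (simp add: power2_eq_square)
    then have "c + n \<le> 3/2" by (rule power2_le_imp_le) simp
    then have "0 \<le> (c + n - 1) * (3/2 - (c + n))" using q by simp
    also have "\<dots> = 5/2 * (c + n) - 3/2 - (c + n)\<^sup>2" by (simp add: power2_eq_square field_simps)
    also have "(c + n)\<^sup>2 = 1 + 2 * (c * n)" using cn(3) by algebra
    finally show ?thesis by argo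
  qed
  then have "s \<le> s * (c + n - 4/5 * (c * n))" using s by simp
  then have half: "1/2 < X" "X' < 1/2" using X(3) X'(3) s by argo+
  define w where "w = (1/2 - X') / (X - X')"
  have "w * (X - X') = 1/2 - X'" using half by (simp add: w_def)
  then have "(1 - w) * X' + w * X = 1/2" by (simp add: algebra_simps)
  moreover have "0 \<le> w" "w \<le> 1" using half by (auto simp: w_def)
  ultimately have w: "0 \<le> w" "w \<le> 1" "(1 - w) * X' + w * X = 1/2" by auto
  define z where "z = (1 - w) * Y' + w * Y"
  have conv: "convex S"
    using is_square_obtain_sq[OF S(1)] convex_sq by metis
  have "(1 - w) *\<^sub>R (X', Y') + w *\<^sub>R (X, Y) = (1/2, z)"
    by (simp add: w(3) z_def)
  moreover have "(1 - w) * (Y' + 4/5 * s) + w * (Y + 4/5 * s) = z + 4/5 * s"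
    by (simp add: z_def field_simps)
  then have "(1 - w) *\<^sub>R (X', Y' + 4/5 * s) + w *\<^sub>R (X, Y + 4/5 * s) = (1/2, z + 4/5 * s)"
    by (simp add: w(3))
  ultimately have z: "(1/2, z) \<in> S" "(1/2, z + 4/5 * s) \<in> S"
    using convexD_alt[OF conv X'(1) X(1) w(1,2)] convexD_alt[OF conv X'(2) X(2) w(1,2)] by (simp_all only:)
  moreover have "0 \<le> z" "z + 4/5 * s \<le> h" using z S(2) by auto
  ultimately show thesis using that by blast
qed

text \<open>
  Sides above \<open>1/2\<close> force the three squares to be pairwise stacked, so their midline chords do
  not overlap.
\<close>
lemma three_squares_short:
  assumes sq: "is_square S0 s0" "is_square S1 s1" "is_square S2 s2"
    and sub: "S0 \<subseteq> {0..1} \<times> {0..h}" "S1 \<subseteq> {0..1} \<times> {0..h}" "S2 \<subseteq> {0..1} \<times> {0..h}"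
    and disj: "interior S0 \<inter> interior S1 = {}" "interior S0 \<inter> interior S2 = {}"
      "interior S1 \<inter> interior S2 = {}"
    and h: "1 \<le> h" "h \<le> 2"
  shows "s0 + s1 + s2 \<le> h + 1/2"
proof (rule ccontr)
  assume "\<not> ?thesis"
  then have sum: "h + 1/2 < s0 + s1 + s2" by simp
  have pair: "s0 + s1 \<le> h" "s0 + s2 \<le> h" "s1 + s2 \<le> h"
    using two_square_side_sum_le[OF sq(1) sub(1) sq(2) sub(2) disj(1) h(1)]
      two_square_side_sum_le[OF sq(1) sub(1) sq(3) sub(3) disj(2) h(1)]
      two_square_side_sum_le[OF sq(2) sub(2) sq(3) sub(3) disj(3) h(1)] .
  have half: "1/2 < s0" "1/2 < s1" "1/2 < s2" using sum pair by linarith+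
  obtain z0 where z0: "0 \<le> z0" "z0 + 4/5 * s0 \<le> h" "(1/2, z0) \<in> S0" "(1/2, z0 + 4/5 * s0) \<in> S0"
    using midline_chord[OF sq(1) sub(1) half(1)] .
  obtain z1 where z1: "0 \<le> z1" "z1 + 4/5 * s1 \<le> h" "(1/2, z1) \<in> S1" "(1/2, z1 + 4/5 * s1) \<in> S1"
    using midline_chord[OF sq(2) sub(2) half(2)] .
  obtain z2 where z2: "0 \<le> z2" "z2 + 4/5 * s2 \<le> h" "(1/2, z2) \<in> S2" "(1/2, z2 + 4/5 * s2) \<in> S2"
    using midline_chord[OF sq(3) sub(3) half(3)] .
  have strip: "S0 \<subseteq> {0..1} \<times> UNIV" "S1 \<subseteq> {0..1} \<times> UNIV" "S2 \<subseteq> {0..1} \<times> UNIV"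
    using sub by auto
  have order: "y \<le> y'" if "stacked S S'" "(1/2, y) \<in> S" "(1/2, y') \<in> S'" for S S' y y'
    using that unfolding stacked_def by (fastforce dest: belowD aboveD)
  have wide: "1 < s0 + s1" "1 < s0 + s2" "1 < s1 + s2" using half by linarith+
  have "z0 + 4/5 * s0 \<le> z1 \<or> z1 + 4/5 * s1 \<le> z0"
    using stacked_if_wide[OF sq(1) strip(1) sq(2) strip(2) disj(1) wide(1)]
      order[OF _ z0(4) z1(3)] order[OF _ z1(4) z0(3)] by blast
  moreover have "z0 + 4/5 * s0 \<le> z2 \<or> z2 + 4/5 * s2 \<le> z0"
    using stacked_if_wide[OF sq(1) strip(1) sq(3) strip(3) disj(2) wide(2)]
      order[OF _ z0(4) z2(3)] order[OF _ z2(4) z0(3)] by blast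
  moreover have "z1 + 4/5 * s1 \<le> z2 \<or> z2 + 4/5 * s2 \<le> z1"
    using stacked_if_wide[OF sq(2) strip(2) sq(3) strip(3) disj(3) wide(3)]
      order[OF _ z1(4) z2(3)] order[OF _ z2(4) z1(3)] by blast
  ultimately have "4/5 * (s0 + s1 + s2) \<le> h" using z0(1,2) z1(1,2) z2(1,2) half by argo
  then show False using sum h by argo
qed

section \<open>Packings and the value of the maximum\<close>

lemma total_side_lengths_3E:
  assumes "t \<in> total_side_lengths 3 x"
  obtains S0 S1 S2 s0 s1 s2 where "t = s0 + s1 + s2"
    "is_square S0 s0" "is_square S1 s1" "is_square S2 s2"
    "S0 \<subseteq> {0..1} \<times> {0..x}" "S1 \<subseteq> {0..1} \<times> {0..x}" "S2 \<subseteq> {0..1} \<times> {0..x}"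
    "interior S0 \<inter> interior S1 = {}" "interior S0 \<inter> interior S2 = {}"
    "interior S1 \<inter> interior S2 = {}"
proof -
  obtain S s where t: "t = (\<Sum>i<3. s i)" and pack: "square_packing 3 x S s"
    using assms unfolding total_side_lengths_def by blast
  have sq: "is_square (S i) (s i)" "S i \<subseteq> {0..1} \<times> {0..x}" if "i < 3" for i
    using pack that unfolding square_packing_def by blast+
  have disj: "interior (S i) \<inter> interior (S j) = {}" if "i < 3" "j < 3" "i \<noteq> j" for i j
    using pack that unfolding square_packing_def disjoint_family_on_def by blast
  have "t = s 0 + s 1 + s 2" by (simp add: t numeral_3_eq_3 numeral_2_eq_2)
  then show thesis
    by (rule that[OF _ sq(1)[of 0] sq(1)[of 1] sq(1)[of 2] sq(2)[of 0] sq(2)[of 1] sq(2)[of 2]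
          disj[of 0 1] disj[of 0 2] disj[of 1 2]]) simp_all
qed

lemma is_square_axis_parallel:
  assumes "s > 0"
  shows "is_square ({a..a + s} \<times> {b..b + s}) s"
proof -
  have "{a..a + s} \<times> {b..b + s} = sq a b 1 0 s"
  proof (intro equalityI subsetI)
    fix p assume "p \<in> {a..a + s} \<times> {b..b + s}"
    then show "p \<in> sq a b 1 0 s"
      by (cases p) (auto intro!: sqI[of "fst p - a" _ "snd p - b"])
  qed (auto simp: sq_def)
  then show ?thesis using is_square_sq[OF assms, of 1 0 a b] by simp
qed

lemma axis_parallel_packing:
  fixes a b s :: "nat \<Rightarrow> real"
  assumes "\<And>i. i < 3 \<Longrightarrow> 0 < s i \<and> 0 \<le> a i \<and> a i + s i \<le> 1 \<and> 0 \<le> b i \<and> b i + s i \<le> x"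
    and "\<And>i j. i < j \<Longrightarrow> j < 3 \<Longrightarrow> a i + s i \<le> a j \<or> b i + s i \<le> b j"
  shows "s 0 + s 1 + s 2 \<in> total_side_lengths 3 x"
proof -
  define S where "S i = {a i..a i + s i} \<times> {b i..b i + s i}" for i
  have int: "interior (S i) = {a i<..<a i + s i} \<times> {b i<..<b i + s i}" for i
    by (simp add: S_def interior_Times interior_atLeastAtMost_real)
  have lt: "interior (S i) \<inter> interior (S j) = {}" if "i < j" "j < 3" for i j
    using assms(2)[OF that] unfolding int by auto
  have "interior (S i) \<inter> interior (S j) = {}" if "i < 3" "j < 3" "i \<noteq> j" for i j
    using lt[of i j] lt[of j i] that by (cases "i < j") auto
  then have "disjoint_family_on (\<lambda>i. interior (S i)) {..<3}"
    unfolding disjoint_family_on_def by simp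
  moreover have "is_square (S i) (s i) \<and> S i \<subseteq> {0..1} \<times> {0..x}" if "i < 3" for i
    using assms(1)[OF that] unfolding S_def
    by (intro conjI is_square_axis_parallel Sigma_mono) auto
  ultimately have "square_packing 3 x S s" unfolding square_packing_def by blast
  moreover have "s 0 + s 1 + s 2 = (\<Sum>i<3. s i)" by (simp add: numeral_3_eq_3 numeral_2_eq_2)
  ultimately show ?thesis unfolding total_side_lengths_def by blast
qed

lemma three_axis_parallel_squares:
  assumes pos: "0 < s0" "0 < s1" "0 < s2"
    and sub: "0 \<le> a0" "a0 + s0 \<le> 1" "0 \<le> b0" "b0 + s0 \<le> x"
      "0 \<le> a1" "a1 + s1 \<le> 1" "0 \<le> b1" "b1 + s1 \<le> x"
      "0 \<le> a2" "a2 + s2 \<le> 1" "0 \<le> b2" "b2 + s2 \<le> x"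
    and apart: "a0 + s0 \<le> a1 \<or> b0 + s0 \<le> b1" "a0 + s0 \<le> a2 \<or> b0 + s0 \<le> b2"
      "a1 + s1 \<le> a2 \<or> b1 + s1 \<le> b2"
  shows "s0 + s1 + s2 \<in> total_side_lengths 3 x"
proof -
  have three: "i = 0 \<or> i = 1 \<or> i = 2" if "i < 3" for i :: nat using that by linarith
  have "([s0, s1, s2] ! 0) + ([s0, s1, s2] ! 1) + ([s0, s1, s2] ! 2) \<in> total_side_lengths 3 x"
  proof (rule axis_parallel_packing[where a = "\<lambda>i. [a0, a1, a2] ! i" and b = "\<lambda>i. [b0, b1, b2] ! i"])
    fix i j :: nat assume "i < j" "j < 3"
    then have "i = 0 \<and> j = 1 \<or> i = 0 \<and> j = 2 \<or> i = 1 \<and> j = 2" by linarith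
    then show "[a0, a1, a2] ! i + [s0, s1, s2] ! i \<le> [a0, a1, a2] ! j \<or>
        [b0, b1, b2] ! i + [s0, s1, s2] ! i \<le> [b0, b1, b2] ! j"
      using apart by auto
  next
    fix i :: nat assume "i < 3"
    then show "0 < [s0, s1, s2] ! i \<and> 0 \<le> [a0, a1, a2] ! i \<and> [a0, a1, a2] ! i + [s0, s1, s2] ! i \<le> 1 \<and>
        0 \<le> [b0, b1, b2] ! i \<and> [b0, b1, b2] ! i + [s0, s1, s2] ! i \<le> x"
      using three[of i] pos sub by auto
  qed
  then show ?thesis by simp
qed

lemma total_side_lengths_3_le:
  assumes t: "t \<in> total_side_lengths 3 x"
  shows "1 \<le> x \<Longrightarrow> x \<le> 3/2 \<Longrightarrow> t \<le> x + 1/2" "x \<le> 2 \<Longrightarrow> t \<le> 2" "2 \<le> x \<Longrightarrow> t \<le> x" "t \<le> 3"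
proof -
  obtain S0 S1 S2 s0 s1 s2 where t: "t = s0 + s1 + s2"
    and sq: "is_square S0 s0" "is_square S1 s1" "is_square S2 s2"
    and sub: "S0 \<subseteq> {0..1} \<times> {0..x}" "S1 \<subseteq> {0..1} \<times> {0..x}" "S2 \<subseteq> {0..1} \<times> {0..x}"
    and disj: "interior S0 \<inter> interior S1 = {}" "interior S0 \<inter> interior S2 = {}"
      "interior S1 \<inter> interior S2 = {}"
    using total_side_lengths_3E[OF t] .
  show "t \<le> x + 1/2" if "1 \<le> x" "x \<le> 3/2"
    using three_squares_short[OF sq sub disj] that t by simp
  show "t \<le> x" if "2 \<le> x"
    using three_squares_tall[OF sq sub disj that] t by simp
  \<comment> \<open>A rectangle of height at most 2 is part of one of height 2.\<close>
  show "t \<le> 2" if "x \<le> 2"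
  proof -
    have "{0..1} \<times> {0..x} \<subseteq> {0..1::real} \<times> {0..2}" using that by auto
    then have "S0 \<subseteq> {0..1} \<times> {0..2}" "S1 \<subseteq> {0..1} \<times> {0..2}" "S2 \<subseteq> {0..1} \<times> {0..2}"
      using sub by blast+
    then show ?thesis using three_squares_tall[OF sq _ _ _ disj, of 2] t by simp
  qed
  have strip: "S0 \<subseteq> {0..1} \<times> UNIV" "S1 \<subseteq> {0..1} \<times> UNIV" "S2 \<subseteq> {0..1} \<times> UNIV"
    using sub by auto
  show "t \<le> 3"
    using strip_side_le[OF sq(1) strip(1)] strip_side_le[OF sq(2) strip(2)]
      strip_side_le[OF sq(3) strip(3)] t by simp
qed

lemma G_3_maximum:
  assumes "v \<in> total_side_lengths 3 x" "\<forall>t \<in> total_side_lengths 3 x. t \<le> v"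
  shows "G 3 x = v"
  unfolding G_def using assms by (intro Greatest_equality) auto

theorem theorem9:
  fixes x :: real
  assumes "x \<ge> 1"
  shows "G 3 x \<in> total_side_lengths 3 x \<and>
    (\<forall>t \<in> total_side_lengths 3 x. t \<le> G 3 x) \<and>
    (1 \<le> x \<and> x \<le> 3/2 \<longrightarrow> G 3 x = x + 1/2) \<and>
    (3/2 \<le> x \<and> x \<le> 2 \<longrightarrow> G 3 x = 2) \<and>
    (2 \<le> x \<and> x \<le> 3 \<longrightarrow> G 3 x = x) \<and>
    (x \<ge> 3 \<longrightarrow> G 3 x = 3)"
proof -
  note le = total_side_lengths_3_le
  consider "x \<le> 3/2" | "3/2 < x" "x \<le> 2" | "2 < x" "x \<le> 3" | "3 < x" by linarith
  then have "\<exists>v \<in> total_side_lengths 3 x. (\<forall>t \<in> total_side_lengths 3 x. t \<le> v) \<and>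
    (1 \<le> x \<and> x \<le> 3/2 \<longrightarrow> v = x + 1/2) \<and> (3/2 \<le> x \<and> x \<le> 2 \<longrightarrow> v = 2) \<and>
    (2 \<le> x \<and> x \<le> 3 \<longrightarrow> v = x) \<and> (x \<ge> 3 \<longrightarrow> v = 3)"
  proof cases
    case 1
    have "1/2 + 1/2 + (x - 1/2) \<in> total_side_lengths 3 x"
      by (rule three_axis_parallel_squares[of _ _ _ 0 0 _ "1/2" 0 0 "1/2"]) (use assms 1 in auto)
    then have "x + 1/2 \<in> total_side_lengths 3 x" by (simp add: add.commute)
    then show ?thesis using le(1) assms 1 by (intro bexI[of _ "x + 1/2"]) auto
  next
    case 2
    have "1/2 + 1/2 + 1 \<in> total_side_lengths 3 x"
      by (rule three_axis_parallel_squares[of _ _ _ 0 0 _ "1/2" 0 0 "1/2"]) (use 2 in auto)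
    then show ?thesis using le(2) 2 by (intro bexI[of _ 2]) auto
  next
    case 3
    have "1 + 1 + (x - 2) \<in> total_side_lengths 3 x"
      by (rule three_axis_parallel_squares[of _ _ _ 0 0 _ 0 1 0 2]) (use 3 in auto)
    then show ?thesis using le(3) 3 by (intro bexI[of _ x]) auto
  next
    case 4
    have "1 + 1 + 1 \<in> total_side_lengths 3 x"
      by (rule three_axis_parallel_squares[of _ _ _ 0 0 _ 0 1 0 2]) (use 4 in auto)
    then show ?thesis using le(4) 4 by (intro bexI[of _ 3]) auto
  qed
  then obtain v where v: "v \<in> total_side_lengths 3 x" "\<forall>t \<in> total_side_lengths 3 x. t \<le> v"
    and cases: "1 \<le> x \<and> x \<le> 3/2 \<longrightarrow> v = x + 1/2" "3/2 \<le> x \<and> x \<le> 2 \<longrightarrow> v = 2"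
      "2 \<le> x \<and> x \<le> 3 \<longrightarrow> v = x" "x \<ge> 3 \<longrightarrow> v = 3" by blast
  show ?thesis unfolding G_3_maximum[OF v] using v cases by blast
qed

end
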